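(* Let $d\in\{1,2\}$, let $\xi,\xi_1,\xi_2,\dots$ be i.i.d. $\mathbb{Z}^d$-valued random variables satisfying A1 (with $d=1$), or A2 or A2' (with $d=2$), let $S(n)=\xi_1+\cdots+\xi_n$ and $R(n)=\{S(1),\dots,S(n)\}$. Then almost surely $(R(n))_{n\ge1}$ is a Følner sequence in $\mathbb{Z}^d$, that is, almost surely, for all $w\in\mathbb{Z}^d$, $$\frac{\#\big[R(n)\,\triangle\,(R(n)+w)\big]}{\#R(n)}\longrightarrow0\qquad\text{as }n\to\infty.$$
   Context: Assumptions on $\xi$, with $\phi_\xi(t)=\mathbb{E}(e^{it\cdot\xi})$: - A1: $d=1$, $\phi_\xi(t)=1-\gamma|t|+o(|t|)$ as $t\to0$ for some $\gamma>0$, and $\xi$ is strongly aperiodic. - A2: $d=2$, $\mathbb{E}|\xi|^2<\infty$, $\mathbb{E}\xi=0$, the covariance matrix $\Sigma$ of $\xi$ is non-singular, and $\xi$ is strongly aperiodic. - A2' (simple random walk): $d=2$ and $\mathbb{P}[\xi=e]=1/4$ for each $e\in\mathbb{Z}^2$ with $|e|=1$. Strongly aperiodic means: there is no proper subgroup $L$ of $\mathbb{Z}^d$ such that $\mathbb{P}(\xi-x\in L)=1$ for some $x\in\mathbb{Z}^d$. $\triangle$ denotes symmetric difference, $\#$ cardinality. *)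

theory Defs
  imports "HOL-Probability.Probability" "HOL-Library.Landau_Symbols"
begin

text \<open>The lattice of rank \<open>d = CARD('n)\<close> is the type \<open>int ^ 'n\<close>, with the discrete sigma-algebra;
  \<open>rvec\<close> embeds it in Euclidean space, which supplies inner product and norm.\<close>

definition rvec :: "int ^ 'n \<Rightarrow> real ^ 'n" where
  "rvec x = (\<chi> i. real_of_int (x $ i))"

text \<open>The library's \<open>char\<close> covers only laws on the real line; this is the version on \<open>real ^ 'n\<close>.\<close>

definition char_fun :: "'a measure \<Rightarrow> ('a \<Rightarrow> int ^ 'n) \<Rightarrow> real ^ 'n \<Rightarrow> complex" where
  "char_fun M \<xi> t = (CLINT \<omega>|M. iexp (t \<bullet> rvec (\<xi> \<omega>)))"

definition mean_vec :: "'a measure \<Rightarrow> ('a \<Rightarrow> int ^ 'n) \<Rightarrow> real ^ 'n" where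
  "mean_vec M \<xi> = (LINT \<omega>|M. rvec (\<xi> \<omega>))"

definition cov_matrix :: "'a measure \<Rightarrow> ('a \<Rightarrow> int ^ 'n) \<Rightarrow> real ^ 'n ^ 'n" where
  "cov_matrix M \<xi> =
     (\<chi> i j. LINT \<omega>|M. (rvec (\<xi> \<omega>) - mean_vec M \<xi>) $ i * (rvec (\<xi> \<omega>) - mean_vec M \<xi>) $ j)"

definition add_subgroup :: "'g :: ab_group_add set \<Rightarrow> bool" where
  "add_subgroup L \<longleftrightarrow> 0 \<in> L \<and> (\<forall>x\<in>L. \<forall>y\<in>L. x + y \<in> L) \<and> (\<forall>x\<in>L. - x \<in> L)"

definition strongly_aperiodic :: "'a measure \<Rightarrow> ('a \<Rightarrow> int ^ 'n) \<Rightarrow> bool" where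
  "strongly_aperiodic M \<xi> \<longleftrightarrow>
     \<not> (\<exists>L. add_subgroup L \<and> L \<noteq> UNIV \<and>
            (\<exists>x. measure M {\<omega> \<in> space M. \<xi> \<omega> - x \<in> L} = 1))"

definition assumption_A1 :: "'a measure \<Rightarrow> ('a \<Rightarrow> int ^ 'n) \<Rightarrow> bool" where
  "assumption_A1 M \<xi> \<longleftrightarrow>
     CARD('n) = 1 \<and>
     (\<exists>\<gamma>>0. (\<lambda>t. char_fun M \<xi> t - complex_of_real (1 - \<gamma> * norm t))
               \<in> o[at 0](\<lambda>t. complex_of_real (norm t))) \<and>
     strongly_aperiodic M \<xi>"

text \<open>Integrability of the squared norm must be explicit, since a divergent Bochner integral
  is \<open>0\<close> by convention.\<close>

definition assumption_A2 :: "'a measure \<Rightarrow> ('a \<Rightarrow> int ^ 'n) \<Rightarrow> bool" where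
  "assumption_A2 M \<xi> \<longleftrightarrow>
     CARD('n) = 2 \<and>
     integrable M (\<lambda>\<omega>. (norm (rvec (\<xi> \<omega>)))\<^sup>2) \<and>
     mean_vec M \<xi> = 0 \<and>
     invertible (cov_matrix M \<xi>) \<and>
     strongly_aperiodic M \<xi>"

definition assumption_A2' :: "'a measure \<Rightarrow> ('a \<Rightarrow> int ^ 'n) \<Rightarrow> bool" where
  "assumption_A2' M \<xi> \<longleftrightarrow>
     CARD('n) = 2 \<and>
     (\<forall>e. norm (rvec e) = 1 \<longrightarrow> measure M {\<omega> \<in> space M. \<xi> \<omega> = e} = 1 / 4)"

definition walk :: "(nat \<Rightarrow> 'a \<Rightarrow> 'g :: ab_group_add) \<Rightarrow> nat \<Rightarrow> 'a \<Rightarrow> 'g" where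
  "walk X n \<omega> = (\<Sum>i = 1..n. X i \<omega>)"

definition walk_range :: "(nat \<Rightarrow> 'a \<Rightarrow> 'g :: ab_group_add) \<Rightarrow> nat \<Rightarrow> 'a \<Rightarrow> 'g set" where
  "walk_range X n \<omega> = (\<lambda>k. walk X k \<omega>) ` {1..n}"

text \<open>A sequence is indexed by \<open>n \<ge> 1\<close>; its value at \<open>0\<close> plays no role in the limit.\<close>

definition folner_seq :: "(nat \<Rightarrow> 'g :: ab_group_add set) \<Rightarrow> bool" where
  "folner_seq F \<longleftrightarrow>
     (\<forall>n\<ge>1. finite (F n) \<and> F n \<noteq> {}) \<and>
     (\<forall>w. (\<lambda>n. real (card (sym_diff (F n) ((\<lambda>x. x + w) ` F n))) / real (card (F n)))
            \<longlonglongrightarrow> 0)"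

end

theory Submission
  imports Defs "HOL-Real_Asymp.Real_Asymp"
begin

text \<open>Let \<open>G n\<close> be the Green function, the expected number of visits to \<open>0\<close> up to time \<open>n\<close>.
  By a last-visit decomposition the probability of not returning to \<open>0\<close> within \<open>n\<close> steps is at most
  \<open>1 / G n\<close>; since the walk is recurrent and irreducible, the same holds up to a constant for the
  probability of avoiding any other point \<open>w\<close>. A point of the range lies in the boundary only if after its
  last visit the walk does not return to it and if the reversed past avoids \<open>w\<close>, so the expected boundary
  at time \<open>n\<close> is of order \<open>n / (G n)\<^sup>2\<close>. As the boundary of a union is contained in the union of the
  boundaries, cutting the walk into independent blocks and applying Hoeffding's inequality turns this
  into an almost sure bound.

  In the other direction, the range has at least \<open>n\<^sup>2 / V\<close> points, where \<open>V\<close> counts the self-intersections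
  and has mean at most \<open>2 n G n\<close>. Thus a block has a small range with probability at most \<open>1 / 2\<close>, and among
  about \<open>sqrt k\<close> independent blocks of a walk of length \<open>2 ^ k\<close> one has a large range, almost surely for all
  large \<open>k\<close>. This loses only a factor \<open>sqrt (ln n)\<close>.

  It remains to see that \<open>G n\<close> is of order \<open>ln n\<close>. In dimension \<open>d\<close>, \<open>1 - \<phi> t\<close> is comparable to \<open>norm t ^ d\<close> on the
  torus in all three cases, so that the Abel sums \<open>\<Sum>k. r ^ k * P (S k = 0)\<close>, which are the integrals of
  \<open>1 / (1 - r * \<phi>)\<close>, grow like \<open>ln (1 / (1 - r))\<close>.\<close>

section \<open>Finite stretches of the walk as random lists\<close>

text \<open>Both estimates are lossy, and the logarithms leave just enough room: a boundary of order
  \<open>n / (ln n)^2\<close> against a range of order at least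
  \<open>n / (ln n * sqrt (ln n))\<close> gives a ratio of order \<open>1 / sqrt (ln n)\<close>. The
  square comes from independence: the future and the reversed past of a point each contribute a
  factor of order \<open>1 / ln n\<close>. The range grows with \<open>n\<close>, so one good block
  and the times \<open>2 ^ k\<close> control it for all \<open>n\<close>. The boundary is not
  monotone and is known only in mean; instead, it is subadditive and invariant under translation,
  hence dominated by a sum of independent bounded terms. For this the blocks have length about
  \<open>sqrt n\<close>: there are then enough of them for concentration to beat the trivial bound
  on each block, while the logarithm of the length is a fixed fraction of \<open>ln n\<close>, so
  that \<open>G\<close> keeps its order. Abel sums suit a symbol that is known only up to constants:
  return probabilities are nonnegative, and at logarithmic growth replacing \<open>n\<close> by a
  power of \<open>n\<close> costs only a constant, so two-sided bounds pass from Abel sums to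
  \<open>G\<close>.\<close>

lemma replicate_pmf_add_conv_pair:
  "replicate_pmf (m + n) p = map_pmf (\<lambda>(xs, ys). xs @ ys) (pair_pmf (replicate_pmf m p) (replicate_pmf n p))"
  by (simp add: replicate_pmf_distrib pair_pmf_def map_pmf_def bind_assoc_pmf bind_return_pmf)

text \<open>The Markov property for finite paths: what follows the first \<open>m\<close> steps is a
  fresh walk, independent of them.\<close>

lemma prob_replicate_pmf_append:
  fixes p :: "'a :: countable pmf"
  shows "measure_pmf.prob (replicate_pmf (m + n) p) {xs. A (take m xs) \<and> B (drop m xs)} =
         measure_pmf.prob (replicate_pmf m p) {xs. A xs} * measure_pmf.prob (replicate_pmf n p) {xs. B xs}"
proof -
  let ?Q = "pair_pmf (replicate_pmf m p) (replicate_pmf n p)"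
  have "measure_pmf.prob (replicate_pmf (m + n) p) {xs. A (take m xs) \<and> B (drop m xs)} =
        measure_pmf.prob ?Q ((\<lambda>(xs, ys). xs @ ys) -` {xs. A (take m xs) \<and> B (drop m xs)})"
    by (simp add: replicate_pmf_add_conv_pair)
  also have "\<dots> = measure_pmf.prob ?Q ({xs. A xs} \<times> {ys. B ys})"
  proof (rule measure_pmf.finite_measure_eq_AE)
    \<comment> \<open>The two sets may differ on pairs of lists of the wrong lengths, which have
      probability zero.\<close>
    show "AE x in measure_pmf ?Q. (x \<in> (\<lambda>(xs, ys). xs @ ys) -` {xs. A (take m xs) \<and> B (drop m xs)}) =
        (x \<in> {xs. A xs} \<times> {ys. B ys})"
      by (auto intro!: AE_pmfI simp: set_replicate_pmf)
  qed auto
  also have "\<dots> = measure_pmf.prob (replicate_pmf m p) {xs. A xs} * measure_pmf.prob (replicate_pmf n p) {xs. B xs}"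
    by (rule measure_pmf_prob_product) auto
  finally show ?thesis .
qed

lemma prob_replicate_pmf_drop:
  fixes p :: "'a :: countable pmf"
  shows "measure_pmf.prob (replicate_pmf (m + n) p) {xs. B (drop m xs)} = measure_pmf.prob (replicate_pmf n p) {xs. B xs}"
  using prob_replicate_pmf_append[of m n p "\<lambda>_. True" B] by simp

lemma prob_replicate_pmf_take:
  fixes p :: "'a :: countable pmf"
  shows "measure_pmf.prob (replicate_pmf (m + n) p) {xs. A (take m xs)} = measure_pmf.prob (replicate_pmf m p) {xs. A xs}"
  using prob_replicate_pmf_append[of m n p A "\<lambda>_. True"] by simp

lemma pmf_replicate_pmf:
  "pmf (replicate_pmf n p) xs = (if length xs = n then prod_list (map (pmf p) xs) else 0)"
proof (induction n arbitrary: xs)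
  case 0
  then show ?case by simp
next
  case (Suc n)
  have eq: "replicate_pmf (Suc n) p = map_pmf (\<lambda>(x, xs). x # xs) (pair_pmf p (replicate_pmf n p))"
    by (simp add: pair_pmf_def map_pmf_def bind_assoc_pmf bind_return_pmf)
  show ?case
  proof (cases xs)
    case Nil
    then have "xs \<notin> set_pmf (replicate_pmf (Suc n) p)"
      unfolding set_replicate_pmf by simp
    then show ?thesis using Nil by (simp add: set_pmf_iff del: replicate_pmf.simps)
  next
    case (Cons y ys)
    have "pmf (replicate_pmf (Suc n) p) ((\<lambda>(x, xs). x # xs) (y, ys)) = pmf (pair_pmf p (replicate_pmf n p)) (y, ys)"
      unfolding eq by (rule pmf_map_inj') (auto simp: inj_on_def)
    then show ?thesis using Cons Suc by (simp add: pmf_pair)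
  qed
qed

text \<open>Time reversal: the weight of a list is a product over its entries, hence the same for
  the reversed list.\<close>

lemma map_rev_replicate_pmf: "map_pmf rev (replicate_pmf n p) = replicate_pmf n p"
proof (rule pmf_eqI)
  fix xs
  have "pmf (map_pmf rev (replicate_pmf n p)) (rev (rev xs)) = pmf (replicate_pmf n p) (rev xs)"
    by (rule pmf_map_inj') simp
  then show "pmf (map_pmf rev (replicate_pmf n p)) xs = pmf (replicate_pmf n p) xs"
    by (simp add: pmf_replicate_pmf rev_map[symmetric])
qed

lemma prob_replicate_pmf_rev:
  "measure_pmf.prob (replicate_pmf n p) {xs. A (rev xs)} = measure_pmf.prob (replicate_pmf n p) {xs. A xs}"
  by (subst (2) map_rev_replicate_pmf[symmetric]) (simp add: vimage_def)

section \<open>Return probabilities, avoidance probabilities and the Green function\<close>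

definition ret_prob :: "'g :: {ab_group_add, countable} pmf \<Rightarrow> nat \<Rightarrow> real" where
  "ret_prob p n = measure_pmf.prob (replicate_pmf n p) {xs. sum_list xs = 0}"

definition avoid_prob :: "'g :: {ab_group_add, countable} pmf \<Rightarrow> 'g \<Rightarrow> nat \<Rightarrow> real" where
  "avoid_prob p w n = measure_pmf.prob (replicate_pmf n p) {xs. \<forall>i\<in>{1..n}. sum_list (take i xs) \<noteq> w}"

definition green :: "'g :: {ab_group_add, countable} pmf \<Rightarrow> nat \<Rightarrow> real" where
  "green p n = (\<Sum>j\<le>n. ret_prob p j)"

definition path_range :: "'g :: ab_group_add list \<Rightarrow> 'g set" where
  "path_range xs = (\<lambda>k. sum_list (take k xs)) ` {1..length xs}"

text \<open>This is \<open>A\<close> minus its translate by \<open>w\<close>. A finite set and its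
  translate have equal size, so it is exactly half of the symmetric difference in the Folner
  ratio.\<close>

definition bdry :: "'g :: ab_group_add \<Rightarrow> 'g set \<Rightarrow> 'g set" where
  "bdry w A = {x \<in> A. x - w \<notin> A}"

lemma ret_prob_0 [simp]: "ret_prob p 0 = 1"
  by (simp add: ret_prob_def)

lemma ret_prob_nonneg: "0 \<le> ret_prob p n" and ret_prob_le_1: "ret_prob p n \<le> 1"
  by (simp_all add: ret_prob_def)

lemma avoid_prob_nonneg: "0 \<le> avoid_prob p w n" and avoid_prob_le_1: "avoid_prob p w n \<le> 1"
  by (simp_all add: avoid_prob_def)

lemma green_mono: "m \<le> n \<Longrightarrow> green p m \<le> green p n"
  unfolding green_def by (rule sum_mono2) (auto simp: ret_prob_nonneg)

lemma green_ge_1: "1 \<le> green p n"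
  using green_mono[of 0 n p] by (simp add: green_def)

lemma avoid_prob_antimono: "m \<le> n \<Longrightarrow> avoid_prob p w n \<le> avoid_prob p w m"
proof -
  assume "m \<le> n"
  then obtain k where n: "n = m + k" using le_Suc_ex by blast
  have "avoid_prob p w n \<le> measure_pmf.prob (replicate_pmf (m + k) p) {xs. \<forall>i\<in>{1..m}. sum_list (take i (take m xs)) \<noteq> w}"
    unfolding avoid_prob_def n by (rule measure_pmf.finite_measure_mono) auto
  also have "\<dots> = avoid_prob p w m"
    unfolding avoid_prob_def by (rule prob_replicate_pmf_take)
  finally show ?thesis .
qed

lemma avoid_prob_green: "avoid_prob p 0 n * green p n \<le> 1"
proof -
  let ?q = "avoid_prob p 0"
  \<comment> \<open>\<open>E j\<close> says that the last visit to 0 up to time \<open>n\<close> is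
    at time \<open>j\<close>, where time 0 counts as a visit. After it a fresh walk avoids 0 for
    \<open>n - j\<close> steps; requiring this for \<open>n\<close> steps only lowers the
    probability.\<close>
  define E where "E j = {xs. sum_list (take j xs) = 0 \<and> (\<forall>i\<in>{1..n-j}. sum_list (take i (drop j xs)) \<noteq> (0::'a))}" for j
  have pE: "measure_pmf.prob (replicate_pmf n p) (E j) = ret_prob p j * ?q (n - j)" if "j \<le> n" for j
    using prob_replicate_pmf_append[of j "n - j" p "\<lambda>xs. sum_list xs = 0"
        "\<lambda>ys. \<forall>i\<in>{1..n-j}. sum_list (take i ys) \<noteq> 0"] that
    by (simp add: E_def ret_prob_def avoid_prob_def)
  have disj: "disjoint_family_on E {..n}"
    unfolding disjoint_family_on_def
  proof (intro ballI impI)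
    have *: "E j \<inter> E k = {}" if "j < k" "k \<le> n" for j k
    proof -
      have False if "xs \<in> E j" "xs \<in> E k" for xs
      proof -
        have "take k xs = take j xs @ take (k - j) (drop j xs)"
          using \<open>j < k\<close> take_add[of j "k-j" xs] by simp
        then have "sum_list (take (k - j) (drop j xs)) = 0"
          using that by (simp add: E_def)
        moreover have "k - j \<in> {1..n-j}" using \<open>j < k\<close> \<open>k \<le> n\<close> by auto
        ultimately show False using that by (auto simp: E_def)
      qed
      then show ?thesis by blast
    qed
    show "E j \<inter> E k = {}" if "j \<in> {..n}" "k \<in> {..n}" "j \<noteq> k" for j k
      using *[of j k] *[of k j] that by (cases "j < k") auto
  qed
  have "?q n * green p n = (\<Sum>j\<le>n. ret_prob p j * ?q n)"
    by (simp add: green_def sum_distrib_left mult.commute)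
  also have "\<dots> \<le> (\<Sum>j\<le>n. ret_prob p j * ?q (n - j))"
    by (intro sum_mono mult_left_mono avoid_prob_antimono) (auto simp: ret_prob_nonneg)
  also have "\<dots> = (\<Sum>j\<le>n. measure_pmf.prob (replicate_pmf n p) (E j))"
    by (simp add: pE)
  also have "\<dots> = measure_pmf.prob (replicate_pmf n p) (\<Union>j\<le>n. E j)"
    by (rule measure_pmf.finite_measure_finite_Union[symmetric]) (use disj in auto)
  also have "\<dots> \<le> 1" by simp
  finally show ?thesis .
qed

lemma avoid_prob_le_inverse_green: "avoid_prob p 0 n \<le> 1 / green p n"
  using avoid_prob_green[of p n] green_ge_1[of p n] by (simp add: field_simps)

section \<open>Reachable points\<close>

definition reach :: "'g :: ab_group_add pmf \<Rightarrow> 'g set" where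
  "reach p = {x. \<exists>xs \<in> lists (set_pmf p). sum_list xs = x}"

text \<open>Irreducibility in the form common to the three cases: strong aperiodicity gives it
  through the shift \<open>x = 0\<close>, and simple random walk has it although parity keeps that
  walk from being strongly aperiodic. It concerns the subgroup generated by the support, whereas
  \<open>reach\<close> is only the submonoid; recurrence closes the gap.\<close>

definition generating :: "'g :: ab_group_add pmf \<Rightarrow> bool" where
  "generating p \<longleftrightarrow> (\<forall>L. add_subgroup L \<longrightarrow> set_pmf p \<subseteq> L \<longrightarrow> L = UNIV)"

lemma zero_in_reach: "0 \<in> reach p"
  unfolding reach_def by (auto intro!: bexI[of _ "[]"])

lemma add_in_reach: "x \<in> reach p \<Longrightarrow> y \<in> reach p \<Longrightarrow> x + y \<in> reach p"
proof -
  assume "x \<in> reach p" "y \<in> reach p"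
  then obtain xs ys where "xs \<in> lists (set_pmf p)" "sum_list xs = x" "ys \<in> lists (set_pmf p)" "sum_list ys = y"
    by (auto simp: reach_def)
  then show ?thesis unfolding reach_def by (auto intro!: bexI[of _ "xs @ ys"])
qed

lemma support_in_reach: "x \<in> set_pmf p \<Longrightarrow> x \<in> reach p"
  unfolding reach_def by (auto intro!: bexI[of _ "[x]"])

text \<open>If \<open>- x\<close> could not be reached, a walk whose first step is \<open>x\<close> would never return to \<open>0\<close>.\<close>

lemma uminus_support_in_reach:
  fixes p :: "'g :: {ab_group_add, countable} pmf"
  assumes rec: "\<And>B. \<exists>n. green p n > B" and x: "x \<in> set_pmf p"
  shows "- x \<in> reach p"
proof (rule ccontr)
  assume nr: "- x \<notin> reach p"
  have lower: "pmf p x \<le> avoid_prob p 0 (Suc n)" for n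
  proof -
    have "pmf p x = measure_pmf.prob (replicate_pmf 1 p) {xs. xs = [x]}"
      using pmf_replicate_pmf[of 1 p "[x]"] by (simp add: measure_pmf_single)
    also have "\<dots> = measure_pmf.prob (replicate_pmf (1 + n) p) {xs. take 1 xs = [x]}"
      by (rule prob_replicate_pmf_take[symmetric])
    also have "\<dots> = measure_pmf.prob (replicate_pmf (1 + n) p) ({xs. take 1 xs = [x]} \<inter> set_pmf (replicate_pmf (1 + n) p))"
      by (rule measure_Int_set_pmf[symmetric])
    also have "\<dots> \<le> measure_pmf.prob (replicate_pmf (1 + n) p) {xs. \<forall>i\<in>{1..1+n}. sum_list (take i xs) \<noteq> 0}"
    proof (rule measure_pmf.finite_measure_mono, safe)
      fix xs i
      assume t: "take 1 xs = [x]" and xs: "xs \<in> set_pmf (replicate_pmf (1 + n) p)"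
        and i: "i \<in> {1..1+n}" and s: "sum_list (take i xs) = 0"
      from t obtain ys where ys: "xs = x # ys" by (cases xs) auto
      have "ys \<in> lists (set_pmf p)" using xs ys unfolding set_replicate_pmf by auto
      then have "take (i - 1) ys \<in> lists (set_pmf p)" by (auto dest: in_set_takeD)
      moreover have "sum_list (take (i - 1) ys) = - x"
        using s i ys by (cases i) (auto simp: eq_neg_iff_add_eq_0 add.commute)
      ultimately show False using nr by (auto simp: reach_def)
    qed auto
    finally show ?thesis by (simp add: avoid_prob_def)
  qed
  have pos: "pmf p x > 0" using x by (simp add: pmf_positive)
  obtain n where n: "green p n > 1 / pmf p x" using rec by blast
  have "pmf p x \<le> 1 / green p (Suc n)"
    using lower[of n] avoid_prob_le_inverse_green[of p "Suc n"] by linarith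
  moreover have "green p (Suc n) > 1 / pmf p x"
    using n green_mono[of n "Suc n" p] by simp
  ultimately show False
    using pos green_ge_1[of p "Suc n"] by (simp add: field_simps)
qed

text \<open>The reachable points whose negatives are reachable too form a subgroup, and by
  recurrence it contains the support.\<close>

lemma reach_eq_UNIV:
  fixes p :: "'g :: {ab_group_add, countable} pmf"
  assumes rec: "\<And>B. \<exists>n. green p n > B" and gen: "generating p"
  shows "reach p = UNIV"
proof -
  let ?L = "{x. x \<in> reach p \<and> - x \<in> reach p}"
  have "add_subgroup ?L"
    using zero_in_reach add_in_reach[of _ p] unfolding add_subgroup_def
    by (fastforce simp: minus_add_distrib)
  moreover have "set_pmf p \<subseteq> ?L"
    using support_in_reach uminus_support_in_reach[OF rec] by blast
  ultimately have "?L = UNIV" using gen unfolding generating_def by blast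
  then show ?thesis by blast
qed

text \<open>A path from \<open>0\<close> to \<open>- w\<close> that is cut at its last visit to \<open>0\<close>, followed by a stretch that
  avoids \<open>w\<close>, is a path that avoids \<open>0\<close>.\<close>

lemma avoid_prob_le_avoid_zero:
  fixes p :: "'g :: {ab_group_add, countable} pmf"
  assumes w: "- w \<in> reach p" "w \<noteq> 0"
  shows "\<exists>C>0. \<forall>n. avoid_prob p w n \<le> C * avoid_prob p 0 n"
proof -
  obtain xs where xs: "xs \<in> lists (set_pmf p)" "sum_list xs = - w"
    using w by (auto simp: reach_def)
  define k where "k = Max {k. k \<le> length xs \<and> sum_list (take k xs) = 0}"
  have k: "k \<in> {k. k \<le> length xs \<and> sum_list (take k xs) = 0}"
    unfolding k_def by (rule Max_in) (auto intro!: exI[of _ 0])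
  have kmax: "j \<le> k" if "j \<le> length xs" "sum_list (take j xs) = 0" for j
    unfolding k_def using that by (intro Max_ge) auto
  define ys where "ys = drop k xs"
  have ys: "ys \<in> lists (set_pmf p)" using xs by (auto simp: ys_def dest: in_set_dropD)
  have sum_ys: "sum_list ys = - w"
    using xs k by (metis (mono_tags, lifting) add_0 append_take_drop_id mem_Collect_eq sum_list_append ys_def)
  have ys_avoid: "sum_list (take i ys) \<noteq> 0" if "i \<in> {1..length ys}" for i
  proof
    assume "sum_list (take i ys) = 0"
    then have "sum_list (take (k + i) xs) = 0" using k by (simp add: take_add ys_def)
    moreover have "k + i \<le> length xs" using that k by (auto simp: ys_def)
    ultimately show False using kmax[of "k + i"] that by simp
  qed
  define m where "m = length ys"
  have "pmf (replicate_pmf m p) ys > 0"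
    using ys by (intro pmf_positive) (auto simp: set_replicate_pmf m_def)
  then have pos: "measure_pmf.prob (replicate_pmf m p) {zs. zs = ys} > 0"
    by (simp add: measure_pmf_single)
  define d where "d = measure_pmf.prob (replicate_pmf m p) {zs. zs = ys}"
  have "d * avoid_prob p w n \<le> avoid_prob p 0 n" for n
  proof -
    have "d * avoid_prob p w n =
      measure_pmf.prob (replicate_pmf (m + n) p) {zs. take m zs = ys \<and> (\<forall>i\<in>{1..n}. sum_list (take i (drop m zs)) \<noteq> w)}"
      unfolding d_def avoid_prob_def by (rule prob_replicate_pmf_append[symmetric])
    also have "\<dots> \<le> avoid_prob p 0 (m + n)"
      unfolding avoid_prob_def
    proof (rule measure_pmf.finite_measure_mono, safe)
      fix zs i
      assume a: "ys = take m zs" "\<forall>i\<in>{1..n}. sum_list (take i (drop m zs)) \<noteq> w"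
        and i: "i \<in> {1..m+n}" and s: "sum_list (take i zs) = 0"
      show False
      proof (cases "i \<le> m")
        case True
        then have "take i zs = take i ys" using a by (simp add: min_def)
        then show False using ys_avoid[of i] i True s by (simp add: m_def)
      next
        case False
        then have "take i zs = ys @ take (i - m) (drop m zs)"
          using take_add[of m "i - m" zs] a by simp
        then have "sum_list (take (i - m) (drop m zs)) = w"
          using s sum_ys by simp
        moreover have "i - m \<in> {1..n}" using False i by auto
        ultimately show False using a by blast
      qed
    qed auto
    also have "\<dots> \<le> avoid_prob p 0 n" by (rule avoid_prob_antimono) simp
    finally show ?thesis .
  qed
  then show ?thesis using pos
    by (intro exI[of _ "1 / d"]) (auto simp: d_def field_simps)
qed

section \<open>The expected boundary of a stretch\<close>

lemma finite_path_range [simp]: "finite (path_range xs)"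
  by (simp add: path_range_def)

lemma card_path_range_le: "card (path_range xs) \<le> length xs"
  unfolding path_range_def using card_image_le[of "{1..length xs}"] by fastforce

lemma card_bdry_le: "finite A \<Longrightarrow> card (bdry w A) \<le> card A"
  by (auto simp: bdry_def intro: card_mono)

text \<open>Each boundary point \<open>x\<close> is charged to the time \<open>k\<close> of its last
  visit. Afterwards the path does not return; and if the last \<open>j\<close> steps before
  \<open>k\<close> summed to \<open>w\<close>, the path would have been at \<open>x - w\<close> at
  time \<open>k - j\<close>. The bound \<open>j \<le> k - 1\<close> matters: \<open>j = k\<close>
  would lead to time 0, whose position is not counted in \<open>path_range\<close>.\<close>

lemma bdry_path_range_subset:
  "bdry w (path_range xs) \<subseteq> (\<lambda>k. sum_list (take k xs)) `
     {k\<in>{1..length xs}. (\<forall>j\<in>{1..k-1}. sum_list (take j (rev (take k xs))) \<noteq> w) \<and>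
        (\<forall>i\<in>{1..length xs - k}. sum_list (take i (drop k xs)) \<noteq> 0)}"
proof
  fix x assume x: "x \<in> bdry w (path_range xs)"
  define K where "K = {k\<in>{1..length xs}. sum_list (take k xs) = x}"
  have K: "finite K" "K \<noteq> {}" using x by (auto simp: K_def bdry_def path_range_def)
  define k where "k = Max K"
  have k: "k \<in> {1..length xs}" "sum_list (take k xs) = x"
    using Max_in[OF K] by (auto simp: k_def K_def)
  have kmax: "j \<le> k" if "j \<in> {1..length xs}" "sum_list (take j xs) = x" for j
    unfolding k_def using that K by (intro Max_ge) (auto simp: K_def)
  have "sum_list (take j (rev (take k xs))) \<noteq> w" if j: "j \<in> {1..k-1}" for j
  proof
    assume w: "sum_list (take j (rev (take k xs))) = w"
    have "take j (rev (take k xs)) = rev (drop (k - j) (take k xs))"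
      using k take_rev[of j "take k xs"] by (simp add: min_absorb2)
    then have "sum_list (drop (k - j) (take k xs)) = w" using w by (simp add: sum_list_rev)
    moreover have "take k xs = take (k - j) xs @ drop (k - j) (take k xs)"
      using append_take_drop_id[of "k - j" "take k xs"] by (simp add: min_def)
    ultimately have "x = sum_list (take (k - j) xs) + w"
      using k by (metis sum_list_append)
    then have "x - w = sum_list (take (k - j) xs)" by simp
    moreover have "k - j \<in> {1..length xs}" using j k by auto
    ultimately show False using x by (auto simp: bdry_def path_range_def)
  qed
  moreover have "sum_list (take i (drop k xs)) \<noteq> 0" if i: "i \<in> {1..length xs - k}" for i
  proof
    assume "sum_list (take i (drop k xs)) = 0"
    then have "sum_list (take (k + i) xs) = x" using k by (simp add: take_add)
    moreover have "k + i \<in> {1..length xs}" using i k(1) by auto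
    ultimately show False using kmax[of "k + i"] i by simp
  qed
  ultimately show "x \<in> (\<lambda>k. sum_list (take k xs)) `
     {k\<in>{1..length xs}. (\<forall>j\<in>{1..k-1}. sum_list (take j (rev (take k xs))) \<noteq> w) \<and>
        (\<forall>i\<in>{1..length xs - k}. sum_list (take i (drop k xs)) \<noteq> 0)}"
    using k by blast
qed

lemma expectation_card_bdry_le:
  fixes p :: "'g :: {ab_group_add, countable} pmf"
  shows "measure_pmf.expectation (replicate_pmf m p) (\<lambda>xs. real (card (bdry w (path_range xs)))) \<le>
         (\<Sum>k\<in>{1..m}. avoid_prob p w (k - 1) * avoid_prob p 0 (m - k))"
proof -
  define E where "E k = {xs. (\<forall>j\<in>{1..k-1}. sum_list (take j (rev (take k xs))) \<noteq> w) \<and>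
        (\<forall>i\<in>{1..m - k}. sum_list (take i (drop k xs)) \<noteq> 0)}" for k
  have pE: "measure_pmf.prob (replicate_pmf m p) (E k) = avoid_prob p w (k - 1) * avoid_prob p 0 (m - k)"
    if k: "k \<in> {1..m}" for k
  proof -
    have "measure_pmf.prob (replicate_pmf (k + (m - k)) p) (E k) =
      measure_pmf.prob (replicate_pmf k p) {xs. \<forall>j\<in>{1..k-1}. sum_list (take j (rev xs)) \<noteq> w} * avoid_prob p 0 (m - k)"
      unfolding E_def avoid_prob_def by (rule prob_replicate_pmf_append)
    \<comment> \<open>Reversal turns the past into a fresh walk of \<open>k\<close> steps. The
      condition reads only \<open>k - 1\<close> of them, so the last one is integrated out.\<close>
    also have "measure_pmf.prob (replicate_pmf k p) {xs. \<forall>j\<in>{1..k-1}. sum_list (take j (rev xs)) \<noteq> w} =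
      measure_pmf.prob (replicate_pmf ((k - 1) + 1) p) {xs. \<forall>j\<in>{1..k-1}. sum_list (take j xs) \<noteq> w}"
      using prob_replicate_pmf_rev[of k p "\<lambda>xs. \<forall>j\<in>{1..k-1}. sum_list (take j xs) \<noteq> w"] k by simp
    also have "\<dots> = measure_pmf.prob (replicate_pmf ((k - 1) + 1) p) {xs. \<forall>j\<in>{1..k-1}. sum_list (take j (take (k - 1) xs)) \<noteq> w}"
      by (rule arg_cong[where f = "measure_pmf.prob _"]) (auto simp: min_def)
    also have "\<dots> = avoid_prob p w (k - 1)"
      unfolding avoid_prob_def by (rule prob_replicate_pmf_take)
    finally show ?thesis using k by simp
  qed
  have card_le: "real (card (bdry w (path_range xs))) \<le> (\<Sum>k\<in>{1..m}. indicator (E k) xs)"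
    if "xs \<in> set_pmf (replicate_pmf m p)" for xs
  proof -
    have len: "length xs = m" using that by (simp add: set_replicate_pmf)
    have "card (bdry w (path_range xs)) \<le> card ((\<lambda>k. sum_list (take k xs)) ` {k\<in>{1..m}. xs \<in> E k})"
      using bdry_path_range_subset[of w xs] unfolding len E_def by (intro card_mono) auto
    also have "\<dots> \<le> card {k\<in>{1..m}. xs \<in> E k}"
      by (rule card_image_le) simp
    finally have "real (card (bdry w (path_range xs))) \<le> real (card {k\<in>{1..m}. xs \<in> E k})"
      by simp
    also have "\<dots> = (\<Sum>k\<in>{1..m}. indicator (E k) xs)"
      by (simp add: indicator_def sum.If_cases Int_def)
    finally show ?thesis .
  qed
  have int: "integrable (measure_pmf (replicate_pmf m p)) (indicator (E k) :: _ \<Rightarrow> real)" for k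
    by (rule measure_pmf.integrable_const_bound[where B = 1]) (auto simp: indicator_def)
  have "measure_pmf.expectation (replicate_pmf m p) (\<lambda>xs. real (card (bdry w (path_range xs)))) \<le>
        measure_pmf.expectation (replicate_pmf m p) (\<lambda>xs. \<Sum>k\<in>{1..m}. indicator (E k) xs)"
  proof (rule integral_mono_AE)
    show "integrable (measure_pmf (replicate_pmf m p)) (\<lambda>xs. real (card (bdry w (path_range xs))))"
    proof (rule measure_pmf.integrable_const_bound[where B = "real m"])
      show "AE xs in measure_pmf (replicate_pmf m p). norm (real (card (bdry w (path_range xs)))) \<le> real m"
      proof (rule AE_pmfI)
        fix xs assume "xs \<in> set_pmf (replicate_pmf m p)"
        then have "length xs = m" by (simp add: set_replicate_pmf)
        then show "norm (real (card (bdry w (path_range xs)))) \<le> real m"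
          using card_bdry_le[OF finite_path_range, of w xs] card_path_range_le[of xs] by simp
      qed
    qed auto
    show "integrable (measure_pmf (replicate_pmf m p)) (\<lambda>xs. \<Sum>k\<in>{1..m}. indicator (E k) xs :: real)"
      by (intro Bochner_Integration.integrable_sum int)
    show "AE xs in measure_pmf (replicate_pmf m p). real (card (bdry w (path_range xs))) \<le> (\<Sum>k\<in>{1..m}. indicator (E k) xs)"
      using card_le by (intro AE_pmfI) auto
  qed
  also have "\<dots> = (\<Sum>k\<in>{1..m}. measure_pmf.prob (replicate_pmf m p) (E k))"
    by (subst Bochner_Integration.integral_sum) (auto intro: int)
  also have "\<dots> = (\<Sum>k\<in>{1..m}. avoid_prob p w (k - 1) * avoid_prob p 0 (m - k))"
    by (rule sum.cong) (auto simp: pE)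
  finally show ?thesis .
qed

text \<open>The product of the two avoidance probabilities is decoupled by
  \<open>2 * a * b \<le> a^2 + b^2\<close>, which leaves a sum of squares over the times below
  \<open>s^2\<close>. Times below \<open>s\<close> are bounded by 1 and contribute \<open>s\<close>;
  from \<open>s\<close> on, each square is at most \<open>(1 / green p s)^2\<close>. Since
  \<open>s\<close> and \<open>s^2\<close> have comparable logarithms, nothing of importance is lost
  by evaluating \<open>green\<close> at \<open>s\<close>.\<close>

lemma expectation_card_bdry_square_le:
  fixes p :: "'g :: {ab_group_add, countable} pmf"
  assumes rec: "\<And>B. \<exists>n. green p n > B" and gen: "generating p"
  shows "\<exists>C>0. \<forall>s. measure_pmf.expectation (replicate_pmf (s\<^sup>2) p) (\<lambda>xs. real (card (bdry w (path_range xs))))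
           \<le> C * (real s + (real s / green p s)\<^sup>2)"
proof (cases "w = 0")
  case True
  then show ?thesis by (auto intro!: exI[of _ 1] simp: bdry_def add_nonneg_nonneg)
next
  case False
  let ?q = "avoid_prob p 0"
  obtain C where C: "C > 0" "\<And>n. avoid_prob p w n \<le> C * ?q n"
    using avoid_prob_le_avoid_zero[of w p] reach_eq_UNIV[OF rec gen] False by auto
  have "measure_pmf.expectation (replicate_pmf (s\<^sup>2) p) (\<lambda>xs. real (card (bdry w (path_range xs))))
           \<le> C * (real s + (real s / green p s)\<^sup>2)" for s :: nat
  proof -
    define m where "m = s\<^sup>2"
    have "(\<Sum>k\<in>{1..m}. avoid_prob p w (k - 1) * ?q (m - k)) \<le>
          (\<Sum>k\<in>{1..m}. C * (((?q (k - 1))\<^sup>2 + (?q (m - k))\<^sup>2) / 2))"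
    proof (rule sum_mono)
      fix k
      have "avoid_prob p w (k - 1) * ?q (m - k) \<le> C * ?q (k - 1) * ?q (m - k)"
        by (intro mult_right_mono C avoid_prob_nonneg)
      also have "\<dots> = C * (?q (k - 1) * ?q (m - k))" by simp
      also have "\<dots> \<le> C * (((?q (k - 1))\<^sup>2 + (?q (m - k))\<^sup>2) / 2)"
        using C sum_squares_bound[of "?q (k - 1)" "?q (m - k)"] by (intro mult_left_mono) auto
      finally show "avoid_prob p w (k - 1) * ?q (m - k) \<le> C * (((?q (k - 1))\<^sup>2 + (?q (m - k))\<^sup>2) / 2)" .
    qed
    also have "\<dots> = C * (((\<Sum>k\<in>{1..m}. (?q (k - 1))\<^sup>2) + (\<Sum>k\<in>{1..m}. (?q (m - k))\<^sup>2)) / 2)"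
      by (simp only: sum_distrib_left[symmetric] sum_divide_distrib[symmetric] sum.distrib)
    also have "(\<Sum>k\<in>{1..m}. (?q (k - 1))\<^sup>2) = (\<Sum>i<m. (?q i)\<^sup>2)"
      by (rule sum.reindex_bij_witness[where i = Suc and j = "\<lambda>k. k - 1"]) auto
    also have "(\<Sum>k\<in>{1..m}. (?q (m - k))\<^sup>2) = (\<Sum>i<m. (?q i)\<^sup>2)"
      by (rule sum.reindex_bij_witness[where i = "\<lambda>i. m - i" and j = "\<lambda>k. m - k"]) auto
    also have "(\<Sum>i<m. (?q i)\<^sup>2) \<le> real s + (real s / green p s)\<^sup>2"
    proof -
      have "(\<Sum>i<m. (?q i)\<^sup>2) \<le> (\<Sum>i<m. (if i < s then 1 else 0) + (1 / green p s)\<^sup>2)"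
      proof (rule sum_mono)
        fix i
        show "(?q i)\<^sup>2 \<le> (if i < s then 1 else 0) + (1 / green p s)\<^sup>2"
        proof (cases "i < s")
          case True
          have "(?q i)\<^sup>2 \<le> 1" using avoid_prob_nonneg[of p 0 i] avoid_prob_le_1[of p 0 i]
            by (simp add: power_le_one)
          moreover have "0 \<le> (1 / green p s)\<^sup>2" by simp
          ultimately have "(?q i)\<^sup>2 \<le> 1 + (1 / green p s)\<^sup>2" by linarith
          then show ?thesis using True by simp
        next
          case False
          then have "?q i \<le> 1 / green p s"
            using avoid_prob_antimono[of s i p 0] avoid_prob_le_inverse_green[of p s] by simp
          then show ?thesis using False avoid_prob_nonneg[of p 0 i] by (auto intro: power_mono)
        qed
      qed
      also have "\<dots> = real (card ({..<m} \<inter> {i. i < s})) + real m * (1 / green p s)\<^sup>2"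
        by (simp add: sum.distrib sum.If_cases)
      also have "card ({..<m} \<inter> {i. i < s}) \<le> s"
        using card_mono[of "{..<s}" "{..<m} \<inter> {i. i < s}"] by auto
      finally show ?thesis by (simp add: m_def power_divide power2_eq_square)
    qed
    finally have "(\<Sum>k\<in>{1..m}. avoid_prob p w (k - 1) * ?q (m - k)) \<le> C * (real s + (real s / green p s)\<^sup>2)"
      using C by (simp add: distrib_left)
    then show ?thesis using expectation_card_bdry_le[of m p w] by (simp add: m_def)
  qed
  then show ?thesis using C by blast
qed

section \<open>A lower bound on the range of a stretch\<close>

text \<open>Cauchy-Schwarz for the occupation numbers \<open>l x\<close>: they sum to
  \<open>card A\<close>, and their squares sum to the number of colliding pairs.\<close>

lemma card_squared_le_card_image_times_collisions:
  assumes "finite A"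
  shows "(real (card A))\<^sup>2 \<le> real (card (f ` A)) * (\<Sum>i\<in>A. \<Sum>j\<in>A. if f i = f j then 1 else 0)"
proof -
  define l where "l x = real (card {i\<in>A. f i = x})" for x
  have l: "l x = (\<Sum>i\<in>A. if f i = x then 1 else 0)" for x
    using assms by (simp add: l_def sum.If_cases Int_def)
  have "(\<Sum>x\<in>f`A. l x) = (\<Sum>i\<in>A. \<Sum>x\<in>f`A. if f i = x then 1 else 0)"
    unfolding l by (rule sum.swap)
  also have "\<dots> = real (card A)" using assms by simp
  finally have s1: "(\<Sum>x\<in>f`A. l x) = real (card A)" .
  have "(\<Sum>x\<in>f`A. (l x)\<^sup>2) = (\<Sum>x\<in>f`A. \<Sum>i\<in>A. if f i = x then l (f i) else 0)"
    by (rule sum.cong) (auto simp: power2_eq_square l sum_distrib_right intro!: sum.cong)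
  also have "\<dots> = (\<Sum>i\<in>A. \<Sum>x\<in>f`A. if f i = x then l (f i) else 0)"
    by (rule sum.swap)
  also have "\<dots> = (\<Sum>i\<in>A. l (f i))" using assms by simp
  also have "\<dots> = (\<Sum>i\<in>A. \<Sum>j\<in>A. if f i = f j then 1 else 0)"
    unfolding l by (intro sum.cong) auto
  finally have s2: "(\<Sum>x\<in>f`A. (l x)\<^sup>2) = (\<Sum>i\<in>A. \<Sum>j\<in>A. if f i = f j then 1 else 0)" .
  have "(\<Sum>x\<in>f`A. 1 * l x)\<^sup>2 \<le> (\<Sum>x\<in>f`A. 1\<^sup>2) * (\<Sum>x\<in>f`A. (l x)\<^sup>2)"
    by (rule Cauchy_Schwarz_ineq_sum)
  then show ?thesis by (simp add: s1 s2)
qed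

lemma prob_collision:
  fixes p :: "'g :: {ab_group_add, countable} pmf"
  assumes "i \<le> j" "j \<le> L"
  shows "measure_pmf.prob (replicate_pmf L p) {xs. sum_list (take i xs) = sum_list (take j xs)} = ret_prob p (j - i)"
proof -
  have "{xs. sum_list (take i xs) = sum_list (take j xs)} = {xs. sum_list (take (j - i) (drop i xs)) = (0 :: 'g)}"
  proof -
    have "sum_list (take j xs) = sum_list (take i xs) + sum_list (take (j - i) (drop i xs))" for xs :: "'g list"
      using assms take_add[of i "j - i" xs] by simp
    then show ?thesis by auto
  qed
  then have "measure_pmf.prob (replicate_pmf L p) {xs. sum_list (take i xs) = sum_list (take j xs)} =
     measure_pmf.prob (replicate_pmf (i + ((j - i) + (L - j))) p) {xs. sum_list (take (j - i) (drop i xs)) = (0 :: 'g)}"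
    using assms by simp
  also have "\<dots> = measure_pmf.prob (replicate_pmf ((j - i) + (L - j)) p) {xs. sum_list (take (j - i) xs) = (0 :: 'g)}"
    by (rule prob_replicate_pmf_drop)
  also have "\<dots> = ret_prob p (j - i)"
    unfolding ret_prob_def by (rule prob_replicate_pmf_take)
  finally show ?thesis .
qed

text \<open>Markov's inequality for the number \<open>V\<close> of self-intersections, at twice the
  bound \<open>2 * L * green p L\<close> on its mean: this is the origin of the constant 4. A range
  smaller than \<open>L / (4 * green p L)\<close> forces \<open>V\<close> above that level by
  Cauchy-Schwarz.\<close>

lemma prob_small_range:
  fixes p :: "'g :: {ab_group_add, countable} pmf"
  assumes L: "L > 0"
  shows "measure_pmf.prob (replicate_pmf L p) {xs. 4 * green p L * real (card (path_range xs)) < real L} \<le> 1 / 2"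
proof -
  let ?P = "measure_pmf (replicate_pmf L p)"
  define V where "V xs = (\<Sum>i\<in>{1..L}. \<Sum>j\<in>{1..L}. if sum_list (take i xs) = sum_list (take j xs) then 1 else 0 :: real)"
    for xs :: "'g list"
  define c where "c i j = {xs. sum_list (take i xs) = sum_list (take j xs :: 'g list)}" for i j
  have V: "V xs = (\<Sum>i\<in>{1..L}. \<Sum>j\<in>{1..L}. indicator (c i j) xs)" for xs
    unfolding V_def c_def by (intro sum.cong refl) (simp add: indicator_def)
  have int: "integrable ?P (indicator (c i j) :: _ \<Rightarrow> real)" for i j
    by (rule measure_pmf.integrable_const_bound[where B = 1]) (auto simp: indicator_def)
  have intV: "integrable ?P V"
    unfolding V by (intro Bochner_Integration.integrable_sum int)
  have "integral\<^sup>L ?P V = (\<Sum>i\<in>{1..L}. \<Sum>j\<in>{1..L}. measure_pmf.prob (replicate_pmf L p) (c i j))"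
    unfolding V by (simp add: Bochner_Integration.integral_sum Bochner_Integration.integrable_sum int)
  also have "\<dots> \<le> (\<Sum>i\<in>{1..L}. 2 * green p L)"
  proof (rule sum_mono)
    fix i assume i: "i \<in> {1..L}"
    \<comment> \<open>For fixed \<open>i\<close> every time difference occurs at most once on each
      side, so each side is at most one Green sum. The diagonal is counted twice, which is harmless
      for an upper bound.\<close>
    have "(\<Sum>j\<in>{1..L}. measure_pmf.prob (replicate_pmf L p) (c i j)) \<le>
          (\<Sum>j\<in>{1..L}. (if i \<le> j then ret_prob p (j - i) else 0) + (if j \<le> i then ret_prob p (i - j) else 0))"
    proof (rule sum_mono)
      fix j assume j: "j \<in> {1..L}"
      have "c i j = c j i" by (auto simp: c_def)
      then show "measure_pmf.prob (replicate_pmf L p) (c i j) \<le>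
          (if i \<le> j then ret_prob p (j - i) else 0) + (if j \<le> i then ret_prob p (i - j) else 0)"
        using prob_collision[of i j L p] prob_collision[of j i L p] i j ret_prob_nonneg[of p]
        by (cases "i \<le> j") (auto simp: c_def)
    qed
    also have "\<dots> = (\<Sum>j\<in>{j\<in>{1..L}. i \<le> j}. ret_prob p (j - i)) + (\<Sum>j\<in>{j\<in>{1..L}. j \<le> i}. ret_prob p (i - j))"
      by (simp only: sum.distrib sum.inter_filter[OF finite_atLeastAtMost])
    also have "(\<Sum>j\<in>{j\<in>{1..L}. i \<le> j}. ret_prob p (j - i)) = (\<Sum>j\<in>(\<lambda>j. j - i) ` {j\<in>{1..L}. i \<le> j}. ret_prob p j)"
      by (subst sum.reindex) (auto simp: inj_on_def)
    also have "\<dots> \<le> green p L"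
      unfolding green_def by (rule sum_mono2) (auto simp: ret_prob_nonneg)
    also have "(\<Sum>j\<in>{j\<in>{1..L}. j \<le> i}. ret_prob p (i - j)) = (\<Sum>j\<in>(\<lambda>j. i - j) ` {j\<in>{1..L}. j \<le> i}. ret_prob p j)"
      by (subst sum.reindex) (auto simp: inj_on_def)
    also have "\<dots> \<le> green p L"
      unfolding green_def using i by (intro sum_mono2) (auto simp: ret_prob_nonneg)
    finally show "(\<Sum>j\<in>{1..L}. measure_pmf.prob (replicate_pmf L p) (c i j)) \<le> 2 * green p L" by simp
  qed
  finally have EV: "integral\<^sup>L ?P V \<le> 2 * real L * green p L" by (simp add: mult_ac)
  have G: "green p L \<ge> 1" by (rule green_ge_1)
  have "measure_pmf.prob (replicate_pmf L p) {xs. 4 * green p L * real (card (path_range xs)) < real L} \<le>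
        measure_pmf.prob (replicate_pmf L p) {xs. 4 * real L * green p L \<le> V xs}"
  proof (rule measure_pmf.finite_measure_mono_AE)
    show "AE xs in ?P. xs \<in> {xs. 4 * green p L * real (card (path_range xs)) < real L} \<longrightarrow>
            xs \<in> {xs. 4 * real L * green p L \<le> V xs}"
    proof (rule AE_pmfI, safe)
      fix xs assume xs: "xs \<in> set_pmf (replicate_pmf L p)"
        and small: "4 * green p L * real (card (path_range xs)) < real L"
      have len: "length xs = L" using xs by (simp add: set_replicate_pmf)
      have V0: "V xs \<ge> 0" unfolding V_def by (intro sum_nonneg) auto
      have "(real L)\<^sup>2 \<le> real (card (path_range xs)) * V xs"
        using card_squared_le_card_image_times_collisions[of "{1..L}" "\<lambda>k. sum_list (take k xs)"]
        by (simp add: V_def path_range_def len)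
      then have "4 * green p L * (real L)\<^sup>2 \<le> 4 * green p L * real (card (path_range xs)) * V xs"
        using G by (simp add: mult.assoc)
      also have "\<dots> \<le> real L * V xs"
        using small V0 by (intro mult_right_mono) auto
      finally show "4 * real L * green p L \<le> V xs"
        using L by (simp add: power2_eq_square mult_ac)
    qed
  qed auto
  also have "\<dots> = measure_pmf.prob (replicate_pmf L p) {xs \<in> space ?P. 4 * real L * green p L \<le> V xs}"
    by simp
  also have "\<dots> \<le> integral\<^sup>L ?P V / (4 * real L * green p L)"
    using L G by (intro integral_Markov_inequality_measure[where A = "{}"] intV) (auto simp: V_def intro!: sum_nonneg)
  also have "\<dots> \<le> (2 * real L * green p L) / (4 * real L * green p L)"
    using L G by (intro divide_right_mono EV) auto
  also have "\<dots> = 1 / 2" using L G by (simp add: field_simps)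
  finally show ?thesis .
qed

section \<open>Blocks of the walk\<close>

lemma bdry_translate: "bdry w ((+) c ` A) = (+) c ` bdry w A" for w :: "'g :: ab_group_add"
proof -
  have "(c + a) - w \<in> (+) c ` A \<longleftrightarrow> a - w \<in> A" for a
  proof -
    have "(c + a) - w = c + (a - w)" by simp
    then show ?thesis by (auto simp: image_iff)
  qed
  then show ?thesis by (auto simp: bdry_def)
qed

text \<open>Here \<open>B\<close> will be the incomplete stretch after the last full block. It
  enters with its full size, because only its length is controlled.\<close>

lemma card_bdry_Un_le:
  assumes "finite A" "finite B"
  shows "card (bdry w (A \<union> B)) \<le> card (bdry w A) + card B"
proof -
  have "card (bdry w (A \<union> B)) \<le> card (bdry w A \<union> B)"
    using assms by (intro card_mono) (auto simp: bdry_def)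
  also have "\<dots> \<le> card (bdry w A) + card B" by (rule card_Un_le)
  finally show ?thesis .
qed

lemma card_bdry_UN_le:
  assumes "finite I" "\<And>i. i \<in> I \<Longrightarrow> finite (A i)"
  shows "card (bdry w (\<Union>i\<in>I. A i)) \<le> (\<Sum>i\<in>I. card (bdry w (A i)))"
proof -
  have "card (bdry w (\<Union>i\<in>I. A i)) \<le> card (\<Union>i\<in>I. bdry w (A i))"
    using assms by (intro card_mono) (auto simp: bdry_def)
  also have "\<dots> \<le> (\<Sum>i\<in>I. card (bdry w (A i)))" by (rule card_UN_le) fact
  finally show ?thesis .
qed

lemma card_sym_diff_translate:
  fixes A :: "'g :: ab_group_add set"
  assumes "finite A"
  shows "card (sym_diff A ((\<lambda>x. x + w) ` A)) = 2 * card (bdry w A)"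
proof -
  let ?B = "(\<lambda>x. x + w) ` A"
  have mem: "x \<in> ?B \<longleftrightarrow> x - w \<in> A" for x
    by (auto simp: image_iff) (metis diff_add_cancel)
  have AB: "A - ?B = bdry w A"
    using mem by (auto simp: bdry_def)
  have cB: "card ?B = card A" by (rule card_image) (auto simp: inj_on_def)
  have "card (?B - A) = card ?B - card (?B \<inter> A)"
    using assms by (intro card_Diff_subset_Int) auto
  also have "\<dots> = card A - card (A \<inter> ?B)" using cB by (simp add: Int_commute)
  also have "\<dots> = card (A - ?B)"
    using assms by (intro card_Diff_subset_Int[symmetric]) auto
  finally have "card (?B - A) = card (A - ?B)" .
  moreover have "card (sym_diff A ?B) = card (A - ?B) + card (?B - A)"
    using assms by (intro card_Un_disjoint) auto
  ultimately show ?thesis using AB by simp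
qed

text \<open>Steps are numbered from 1, so this is the list of the \<open>L\<close> steps that follow
  time \<open>a\<close>.\<close>

definition block :: "(nat \<Rightarrow> 'a \<Rightarrow> 'g) \<Rightarrow> nat \<Rightarrow> nat \<Rightarrow> 'a \<Rightarrow> 'g list" where
  "block X a L \<omega> = map (\<lambda>i. X i \<omega>) [a + 1..<a + L + 1]"

lemma length_block [simp]: "length (block X a L \<omega>) = L"
  by (simp add: block_def)

lemma walk_add:
  fixes X :: "nat \<Rightarrow> 'a \<Rightarrow> 'g :: ab_group_add"
  assumes "k \<le> L"
  shows "walk X (a + k) \<omega> = walk X a \<omega> + sum_list (take k (block X a L \<omega>))"
proof -
  have "take k (block X a L \<omega>) = map (\<lambda>i. X i \<omega>) [a + 1..<a + k + 1]"
    using assms by (simp add: block_def take_map take_upt del: upt_Suc)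
  then have "sum_list (take k (block X a L \<omega>)) = (\<Sum>i = a + 1..a + k. X i \<omega>)"
    by (simp add: sum_list_distinct_conv_sum_set atLeastLessThanSuc_atLeastAtMost del: upt_Suc)
  then show ?thesis
    unfolding walk_def using sum.ub_add_nat[of 1 a "\<lambda>i. X i \<omega>" k] by simp
qed

text \<open>Because \<open>path_range\<close> omits the starting point, block \<open>j\<close>
  accounts exactly for the times from \<open>j * L + 1\<close> to \<open>j * L + L\<close>, and
  these intervals tile the times from 1 to \<open>N * L\<close>. Hence the division of
  \<open>k - 1\<close>, not of \<open>k\<close>, in the proof.\<close>

lemma walk_range_blocks:
  fixes X :: "nat \<Rightarrow> 'a \<Rightarrow> 'g :: ab_group_add"
  shows "walk_range X (N * L) \<omega> = (\<Union>j<N. (+) (walk X (j * L) \<omega>) ` path_range (block X (j * L) L \<omega>))"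
proof (intro equalityI subsetI)
  fix x assume "x \<in> walk_range X (N * L) \<omega>"
  then obtain k where k: "k \<in> {1..N * L}" "x = walk X k \<omega>" by (auto simp: walk_range_def)
  then have L: "L > 0" by (cases L) auto
  define j where "j = (k - 1) div L"
  define i where "i = (k - 1) mod L + 1"
  have kji: "k = j * L + i" using k by (simp add: i_def j_def)
  have "j < N" using k L by (auto simp: j_def less_mult_imp_div_less)
  moreover have i: "i \<in> {1..L}" using L mod_less_divisor[OF L, of "k - 1"] by (simp add: i_def)
  moreover have "x = walk X (j * L) \<omega> + sum_list (take i (block X (j * L) L \<omega>))"
    using walk_add[of i L X "j * L" \<omega>] i k kji by simp
  ultimately show "x \<in> (\<Union>j<N. (+) (walk X (j * L) \<omega>) ` path_range (block X (j * L) L \<omega>))"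
    by (intro UN_I[of j]) (auto simp: path_range_def)
next
  fix x assume "x \<in> (\<Union>j<N. (+) (walk X (j * L) \<omega>) ` path_range (block X (j * L) L \<omega>))"
  then obtain j i where ji: "j < N" "i \<in> {1..L}"
    "x = walk X (j * L) \<omega> + sum_list (take i (block X (j * L) L \<omega>))"
    by (auto simp: path_range_def)
  then have "x = walk X (j * L + i) \<omega>" using walk_add[of i L X "j * L" \<omega>] by simp
  moreover have "j * L + i \<le> N * L"
  proof -
    have "j * L + i \<le> Suc j * L" using ji by simp
    also have "\<dots> \<le> N * L" using ji by (intro mult_le_mono1) simp
    finally show ?thesis .
  qed
  ultimately show "x \<in> walk_range X (N * L) \<omega>" using ji by (auto simp: walk_range_def)
qed

lemma finite_walk_range [simp]: "finite (walk_range X n \<omega>)"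
  by (simp add: walk_range_def)

lemma card_bdry_walk_range_le:
  fixes X :: "nat \<Rightarrow> 'a \<Rightarrow> 'g :: ab_group_add"
  assumes "N * L \<le> n"
  shows "card (bdry w (walk_range X n \<omega>)) \<le>
    (\<Sum>j<N. card (bdry w (path_range (block X (j * L) L \<omega>)))) + (n - N * L)"
proof -
  let ?B = "(\<lambda>k. walk X k \<omega>) ` {N * L + 1..n}"
  have "{1..n} = {1..N * L} \<union> {N * L + 1..n}" using assms by auto
  then have "walk_range X n \<omega> = walk_range X (N * L) \<omega> \<union> ?B"
    by (simp only: walk_range_def image_Un)
  then have "card (bdry w (walk_range X n \<omega>)) \<le> card (bdry w (walk_range X (N * L) \<omega>)) + card ?B"
    using card_bdry_Un_le[of "walk_range X (N * L) \<omega>" ?B w] by simp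
  moreover have "card ?B \<le> n - N * L"
    using card_image_le[of "{N * L + 1..n}" "\<lambda>k. walk X k \<omega>"] by simp
  moreover have "card (bdry w (walk_range X (N * L) \<omega>)) \<le>
      (\<Sum>j<N. card (bdry w (path_range (block X (j * L) L \<omega>))))"
  proof -
    have "card (bdry w (walk_range X (N * L) \<omega>)) \<le>
      (\<Sum>j<N. card (bdry w ((+) (walk X (j * L) \<omega>) ` path_range (block X (j * L) L \<omega>))))"
      unfolding walk_range_blocks by (rule card_bdry_UN_le) auto
    also have "\<dots> = (\<Sum>j<N. card (bdry w (path_range (block X (j * L) L \<omega>))))"
      unfolding bdry_translate by (intro sum.cong refl card_image) (auto simp: inj_on_def)
    finally show ?thesis .
  qed
  ultimately show ?thesis by linarith
qed

lemma card_path_range_block_le: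
  fixes X :: "nat \<Rightarrow> 'a \<Rightarrow> 'g :: ab_group_add"
  assumes "j < N" "N * L \<le> n"
  shows "card (path_range (block X (j * L) L \<omega>)) \<le> card (walk_range X n \<omega>)"
proof -
  have "card (path_range (block X (j * L) L \<omega>)) = card ((+) (walk X (j * L) \<omega>) ` path_range (block X (j * L) L \<omega>))"
    by (rule card_image[symmetric]) (auto simp: inj_on_def)
  also have "\<dots> \<le> card (walk_range X (N * L) \<omega>)"
    using assms(1) by (intro card_mono) (auto simp: walk_range_blocks)
  also have "\<dots> \<le> card (walk_range X n \<omega>)"
    using assms(2) by (intro card_mono) (auto simp: walk_range_def)
  finally show ?thesis .
qed

locale random_walk = prob_space M for M :: "'a measure" +
  fixes X :: "nat \<Rightarrow> 'a \<Rightarrow> 'g :: {ab_group_add, countable}" and p :: "'g pmf"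
  assumes indep: "indep_vars (\<lambda>_. count_space UNIV) X {1..}"
    and law: "\<And>i. i \<ge> 1 \<Longrightarrow> distr M (count_space UNIV) (X i) = measure_pmf p"
begin

lemma X_measurable: "i \<ge> 1 \<Longrightarrow> X i \<in> measurable M (count_space UNIV)"
  using indep by (auto simp: indep_vars_def)

lemma block_eq_iff:
  "length xs = L \<Longrightarrow> block X a L \<omega> = xs \<longleftrightarrow> (\<forall>i\<in>{a + 1..a + L}. X i \<omega> = xs ! (i - a - 1))"
proof -
  assume xs: "length xs = L"
  have "block X a L \<omega> = xs \<longleftrightarrow> (\<forall>k<L. X (a + 1 + k) \<omega> = xs ! k)"
    using xs by (auto simp: block_def list_eq_iff_nth_eq simp del: upt_Suc)
  also have "\<dots> \<longleftrightarrow> (\<forall>i\<in>{a + 1..a + L}. X i \<omega> = xs ! (i - a - 1))"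
  proof (intro iffI ballI allI impI)
    fix i assume h: "\<forall>k<L. X (a + 1 + k) \<omega> = xs ! k" and i: "i \<in> {a + 1..a + L}"
    have "X (a + 1 + (i - a - 1)) \<omega> = xs ! (i - a - 1)" using h i by (intro h[rule_format]) auto
    then show "X i \<omega> = xs ! (i - a - 1)" using i by simp
  next
    fix k assume h: "\<forall>i\<in>{a + 1..a + L}. X i \<omega> = xs ! (i - a - 1)" and k: "k < L"
    show "X (a + 1 + k) \<omega> = xs ! k" using h[rule_format, of "a + 1 + k"] k by simp
  qed
  finally show ?thesis .
qed

lemma block_vimage:
  assumes "length xs = L" "L > 0"
  shows "block X a L -` {xs} \<inter> space M = (\<Inter>i\<in>{a + 1..a + L}. X i -` {xs ! (i - a - 1)} \<inter> space M)"
proof -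
  have "{a + 1..a + L} \<noteq> {}" using assms by simp
  then show ?thesis using block_eq_iff[OF assms(1), of a] by (simp add: set_eq_iff) blast
qed

lemma block_vimage_sets: "block X a L -` {xs} \<inter> space M \<in> sets M"
proof (cases "length xs = L \<and> L > 0")
  case True
  then show ?thesis
    using X_measurable by (subst block_vimage) (auto intro!: sets.finite_INT measurable_sets)
next
  case False
  then have "block X a L -` {xs} \<inter> space M \<in> {{}, space M}"
    using length_block[of X a L] by (cases "L = 0") (auto simp: block_def)
  then show ?thesis by auto
qed

lemma block_measurable [measurable]: "block X a L \<in> measurable M (count_space UNIV)"
  by (subst measurable_count_space_eq2_countable) (auto intro: block_vimage_sets)

text \<open>The bridge from the walk to random lists. Lists over a countable type are countable, so
  it is enough to compare point masses, and these factor by independence.\<close>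

lemma distr_block: "distr M (count_space UNIV) (block X a L) = measure_pmf (replicate_pmf L p)"
proof (rule measure_eqI_countable[where A = UNIV])
  fix xs :: "'g list"
  have "prob (block X a L -` {xs} \<inter> space M) = pmf (replicate_pmf L p) xs"
  proof (cases "length xs = L")
    case False
    then have "block X a L \<omega> \<noteq> xs" for \<omega> using length_block[of X a L \<omega>] by metis
    then have "block X a L -` {xs} \<inter> space M = {}" by blast
    then show ?thesis using False by (simp add: pmf_replicate_pmf)
  next
    case len: True
    show ?thesis
    proof (cases "L = 0")
      case True
      then have "block X a L -` {xs} \<inter> space M = space M" using len by (auto simp: block_def)
      then show ?thesis using True len by (simp add: prob_space)
    next
      case False
      have "prob (block X a L -` {xs} \<inter> space M) = (\<Prod>i\<in>{a + 1..a + L}. prob (X i -` {xs ! (i - a - 1)} \<inter> space M))"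
        unfolding block_vimage[OF len False[unfolded neq0_conv]]
        using False by (intro indep_varsD[OF indep]) auto
      also have "\<dots> = (\<Prod>i\<in>{a + 1..a + L}. pmf p (xs ! (i - a - 1)))"
      proof (rule prod.cong[OF refl])
        fix i assume i: "i \<in> {a + 1..a + L}"
        have "prob (X i -` {xs ! (i - a - 1)} \<inter> space M) = measure (distr M (count_space UNIV) (X i)) {xs ! (i - a - 1)}"
          using i X_measurable by (subst measure_distr) auto
        also have "\<dots> = pmf p (xs ! (i - a - 1))"
          using i law by (simp add: measure_pmf_single)
        finally show "prob (X i -` {xs ! (i - a - 1)} \<inter> space M) = pmf p (xs ! (i - a - 1))" .
      qed
      also have "\<dots> = (\<Prod>k\<in>{0..<L}. pmf p (xs ! k))"
        by (rule prod.reindex_bij_witness[where i = "\<lambda>k. a + 1 + k" and j = "\<lambda>i. i - a - 1"]) auto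
      also have "\<dots> = pmf (replicate_pmf L p) xs"
        using len by (simp add: pmf_replicate_pmf prod.list_conv_set_nth)
      finally show ?thesis .
    qed
  qed
  then show "emeasure (distr M (count_space UNIV) (block X a L)) {xs} = emeasure (measure_pmf (replicate_pmf L p)) {xs}"
    by (simp add: emeasure_distr emeasure_eq_measure emeasure_pmf_single)
qed auto

lemma prob_block: "prob {\<omega> \<in> space M. P (block X a L \<omega>)} = measure_pmf.prob (replicate_pmf L p) {xs. P xs}"
proof -
  have "prob {\<omega> \<in> space M. P (block X a L \<omega>)} = measure (distr M (count_space UNIV) (block X a L)) {xs. P xs}"
    by (subst measure_distr) (auto intro!: arg_cong[where f = prob])
  then show ?thesis by (simp add: distr_block)
qed

lemma expectation_block:
  "expectation (\<lambda>\<omega>. f (block X a L \<omega>)) = measure_pmf.expectation (replicate_pmf L p) f" for f :: "_ \<Rightarrow> real"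
  by (subst distr_block[of a L, symmetric]) (simp add: integral_distr)

lemma indep_blocks: "indep_vars (\<lambda>_. count_space UNIV) (\<lambda>j. block X (j * L) L) {..<N}"
proof -
  define K where "K j = {j * L + 1..j * L + L}" for j
  have disj: "disjoint_family_on K {..<N}"
  proof -
    have "K i \<inter> K j = {}" if "i < j" for i j
    proof -
      have "Suc i * L \<le> j * L" using that by (intro mult_le_mono1) simp
      then show ?thesis by (auto simp: K_def)
    qed
    then show ?thesis unfolding disjoint_family_on_def by (metis Int_commute nat_neq_iff)
  qed
  have "indep_vars (\<lambda>j. PiM (K j) (\<lambda>_. count_space UNIV)) (\<lambda>j \<omega>. restrict (\<lambda>i. X i \<omega>) (K j)) {..<N}"
    by (rule indep_vars_restrict[OF indep _ disj]) (auto simp: K_def)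
  then have "indep_vars (\<lambda>_. count_space UNIV)
      (\<lambda>j \<omega>. (\<lambda>g. map g [j * L + 1..<j * L + L + 1]) (restrict (\<lambda>i. X i \<omega>) (K j))) {..<N}"
  proof (rule indep_vars_compose2)
    fix j
    show "(\<lambda>g. map g [j * L + 1..<j * L + L + 1]) \<in> measurable (PiM (K j) (\<lambda>_. count_space (UNIV :: 'g set))) (count_space UNIV)"
      by (subst count_space_PiM_finite) (auto simp: K_def)
  qed
  moreover have "(\<lambda>g. map g [j * L + 1..<j * L + L + 1]) (restrict (\<lambda>i. X i \<omega>) (K j)) = block X (j * L) L \<omega>" for j \<omega>
    by (auto simp: block_def K_def)
  ultimately show ?thesis by simp
qed

section \<open>Almost sure bounds\<close>

text \<open>There are \<open>s^2\<close> independent blocks of length \<open>s^2\<close>, each with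
  a boundary of size between 0 and \<open>s^2\<close>. The deviation \<open>t = s^3 * sqrt s\<close>
  makes Hoeffding's exponent \<open>- 2 * t^2 / (s^2 * s^4)\<close> equal to \<open>- 2 * s\<close>,
  which is summable over \<open>s\<close>, while \<open>t\<close> is a power of \<open>s\<close>
  below the total length \<open>s^4\<close>.\<close>

lemma AE_boundary_upper:
  "AE \<omega> in M. \<forall>\<^sub>F s in sequentially. (\<Sum>j<s\<^sup>2. real (card (bdry w (path_range (block X (j * s\<^sup>2) (s\<^sup>2) \<omega>)))))
     < (real s)\<^sup>2 * measure_pmf.expectation (replicate_pmf (s\<^sup>2) p) (\<lambda>xs. real (card (bdry w (path_range xs))))
        + (real s)^3 * sqrt (real s)"
proof -
  define b where "b s = measure_pmf.expectation (replicate_pmf (s\<^sup>2) p) (\<lambda>xs. real (card (bdry w (path_range xs))))" for s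
  define Z where "Z s j \<omega> = real (card (bdry w (path_range (block X (j * s\<^sup>2) (s\<^sup>2) \<omega>))))" for s j \<omega>
  define E where "E s = {\<omega> \<in> space M. (\<Sum>j<s\<^sup>2. Z s j \<omega>) \<ge> (real s)\<^sup>2 * b s + (real s)^3 * sqrt (real s)}" for s
  have Z_meas [measurable]: "Z s j \<in> borel_measurable M" for s j
    unfolding Z_def by measurable
  have E_sets: "E s \<in> sets M" for s unfolding E_def by measurable
  have E_prob: "prob (E s) \<le> exp (- 2) ^ s" for s
  proof (cases "s = 0")
    case True
    then show ?thesis by simp
  next
    case False
    interpret H: Hoeffding_ineq M "{..<s\<^sup>2}" "Z s" "\<lambda>_. 0" "\<lambda>_. real (s\<^sup>2)" "\<Sum>j<s\<^sup>2. expectation (Z s j)"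
    proof unfold_locales
      show "indep_vars (\<lambda>_. borel) (Z s) {..<s\<^sup>2}"
        unfolding Z_def using indep_vars_compose2[OF indep_blocks[of "s\<^sup>2" "s\<^sup>2"],
          of "\<lambda>_ xs. real (card (bdry w (path_range xs)))" "\<lambda>_. borel"] by simp
      show "AE \<omega> in M. Z s j \<omega> \<in> {0..real (s\<^sup>2)}" for j
      proof (rule AE_I2)
        fix \<omega>
        have "card (bdry w (path_range (block X (j * s\<^sup>2) (s\<^sup>2) \<omega>))) \<le> s\<^sup>2"
          using card_bdry_le[OF finite_path_range, of w "block X (j * s\<^sup>2) (s\<^sup>2) \<omega>"]
            card_path_range_le[of "block X (j * s\<^sup>2) (s\<^sup>2) \<omega>"] by simp
        then show "Z s j \<omega> \<in> {0..real (s\<^sup>2)}" unfolding Z_def by (simp only: of_nat_le_iff of_nat_0_le_iff atLeastAtMost_iff)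
      qed
    qed simp_all
    have EZ: "expectation (Z s j) = b s" for j
      unfolding Z_def b_def by (rule expectation_block)
    have "prob (E s) = prob {\<omega>\<in>space M. (\<Sum>j<s\<^sup>2. Z s j \<omega>) \<ge> (\<Sum>j<s\<^sup>2. expectation (Z s j)) + (real s)^3 * sqrt (real s)}"
      unfolding E_def by (simp add: EZ)
    also have "\<dots> \<le> exp (- 2 * ((real s)^3 * sqrt (real s))\<^sup>2 / (\<Sum>j<s\<^sup>2. (real (s\<^sup>2) - 0)\<^sup>2))"
      using False by (intro H.Hoeffding_ineq_ge) auto
    also have "- 2 * ((real s)^3 * sqrt (real s))\<^sup>2 / (\<Sum>j<s\<^sup>2. (real (s\<^sup>2) - 0)\<^sup>2) = real s * (- 2)"
    proof -
      have "((real s)^3 * sqrt (real s))\<^sup>2 = real s * (real s)^6"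
        by (simp add: power_mult_distrib mult.commute)
      moreover have "(\<Sum>j<s\<^sup>2. (real (s\<^sup>2) - 0)\<^sup>2) = (real s)^6"
        by (simp add: power_add[symmetric])
      ultimately show ?thesis using False by simp
    qed
    also have "exp (real s * (- 2)) = exp (- 2) ^ s"
      by (rule exp_of_nat_mult)
    finally show ?thesis .
  qed
  have "AE \<omega> in M. \<forall>\<^sub>F s in sequentially. \<omega> \<in> space M - E s"
  proof (rule borel_cantelli_AE1)
    show "summable (\<lambda>s. prob (E s))"
    proof (rule summable_comparison_test)
      show "\<exists>N. \<forall>s\<ge>N. norm (prob (E s)) \<le> exp (- 2) ^ s" using E_prob by auto
      show "summable (\<lambda>s. exp (- 2 :: real) ^ s)" by (rule summable_geometric) simp
    qed
  qed (auto simp: E_sets less_top[symmetric])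
  then show ?thesis
  proof eventually_elim
    case (elim \<omega>)
    then show ?case
    proof (rule eventually_mono)
      fix s assume "\<omega> \<in> space M - E s"
      then have "(\<Sum>j<s\<^sup>2. Z s j \<omega>) < (real s)\<^sup>2 * b s + (real s)^3 * sqrt (real s)"
        by (simp add: E_def not_le)
      then show "(\<Sum>j<s\<^sup>2. real (card (bdry w (path_range (block X (j * s\<^sup>2) (s\<^sup>2) \<omega>)))))
         < (real s)\<^sup>2 * measure_pmf.expectation (replicate_pmf (s\<^sup>2) p) (\<lambda>xs. real (card (bdry w (path_range xs))))
           + (real s)^3 * sqrt (real s)"
        unfolding Z_def b_def .
    qed
  qed
qed

text \<open>With more than \<open>sqrt k\<close> blocks, each bad with probability at most 1/2, all
  are bad with probability at most \<open>2 powr (- sqrt k)\<close>, which is summable over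
  \<open>k\<close>. Summability is needed only over \<open>k\<close>, not over all times up to
  \<open>2 ^ k\<close>; this is why so few blocks suffice and the block length drops only by a
  factor of about \<open>sqrt k\<close>.\<close>

lemma AE_range_lower:
  "AE \<omega> in M. \<forall>\<^sub>F k in sequentially. \<exists>j < nat \<lfloor>sqrt (real k)\<rfloor> + 1.
     real (2 ^ k div (nat \<lfloor>sqrt (real k)\<rfloor> + 1)) \<le> 4 * green p (2 ^ k div (nat \<lfloor>sqrt (real k)\<rfloor> + 1)) *
      real (card (path_range (block X (j * (2 ^ k div (nat \<lfloor>sqrt (real k)\<rfloor> + 1))) (2 ^ k div (nat \<lfloor>sqrt (real k)\<rfloor> + 1)) \<omega>)))"
proof -
  define K where "K k = nat \<lfloor>sqrt (real k)\<rfloor> + 1" for k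
  define L where "L k = 2 ^ k div K k" for k
  define bad where "bad k = {xs :: 'g list. 4 * green p (L k) * real (card (path_range xs)) < real (L k)}" for k
  define E where "E k = (\<Inter>j\<in>{..<K k}. block X (j * L k) (L k) -` bad k \<inter> space M)" for k
  have K0: "{..<K k} \<noteq> {}" for k by (auto simp: K_def)
  have E_sets: "E k \<in> sets M" for k
    unfolding E_def using K0 by (intro sets.finite_INT measurable_sets[OF block_measurable]) auto
  have E_prob: "prob (E k) \<le> 2 powr (- sqrt (real k))" for k
  proof -
    have "prob (E k) = (\<Prod>j<K k. prob (block X (j * L k) (L k) -` bad k \<inter> space M))"
      unfolding E_def using K0 by (intro indep_varsD_finite[OF indep_blocks]) auto
    also have "\<dots> \<le> (\<Prod>j<K k. 1 / 2)"
    proof (rule prod_mono, safe)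
      fix j
      have "block X (j * L k) (L k) -` bad k \<inter> space M = {\<omega> \<in> space M. block X (j * L k) (L k) \<omega> \<in> bad k}" by auto
      then have "prob (block X (j * L k) (L k) -` bad k \<inter> space M) = measure_pmf.prob (replicate_pmf (L k) p) (bad k)"
        using prob_block[of "\<lambda>xs. xs \<in> bad k"] by simp
      also have "\<dots> \<le> 1 / 2"
      proof (cases "L k = 0")
        case True
        then have "bad k = {}" using green_ge_1[of p 0] by (auto simp: bad_def not_less)
        then show ?thesis by simp
      next
        case False
        then show ?thesis unfolding bad_def by (intro prob_small_range) simp
      qed
      finally show "prob (block X (j * L k) (L k) -` bad k \<inter> space M) \<le> 1 / 2" .
    qed simp
    also have "\<dots> = 2 powr (- real (K k))"
      by (simp add: powr_minus powr_realpow power_one_over inverse_eq_divide)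
    also have "\<dots> \<le> 2 powr (- sqrt (real k))"
    proof -
      have "sqrt (real k) \<le> real (K k)" unfolding K_def by linarith
      then show ?thesis by simp
    qed
    finally show ?thesis .
  qed
  have "AE \<omega> in M. \<forall>\<^sub>F k in sequentially. \<omega> \<in> space M - E k"
  proof (rule borel_cantelli_AE1)
    show "summable (\<lambda>k. prob (E k))"
    proof (rule summable_comparison_test)
      show "\<exists>N. \<forall>k\<ge>N. norm (prob (E k)) \<le> 2 powr (- sqrt (real k))" using E_prob by auto
      show "summable (\<lambda>k. 2 powr (- sqrt (real k)))"
      proof (rule summable_comparison_test_bigo)
        show "summable (\<lambda>k. norm (1 / real k ^ 2))" using inverse_power_summable[of 2] by (simp add: divide_inverse)
        show "(\<lambda>k. 2 powr (- sqrt (real k))) \<in> O(\<lambda>k. 1 / real k ^ 2)" by real_asymp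
      qed
    qed
  qed (auto simp: E_sets less_top[symmetric])
  then show ?thesis
  proof eventually_elim
    case (elim \<omega>)
    then show ?case
    proof (rule eventually_mono)
      fix k assume "\<omega> \<in> space M - E k"
      then obtain j where "j < K k" "block X (j * L k) (L k) \<omega> \<notin> bad k"
        unfolding E_def by blast
      then have "\<exists>j<K k. real (L k) \<le> 4 * green p (L k) * real (card (path_range (block X (j * L k) (L k) \<omega>)))"
        by (auto simp: bad_def not_less)
      then show "\<exists>j < nat \<lfloor>sqrt (real k)\<rfloor> + 1.
       real (2 ^ k div (nat \<lfloor>sqrt (real k)\<rfloor> + 1)) \<le> 4 * green p (2 ^ k div (nat \<lfloor>sqrt (real k)\<rfloor> + 1)) *
        real (card (path_range (block X (j * (2 ^ k div (nat \<lfloor>sqrt (real k)\<rfloor> + 1))) (2 ^ k div (nat \<lfloor>sqrt (real k)\<rfloor> + 1)) \<omega>)))"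
        unfolding L_def K_def .
    qed
  qed
qed

lemma AE_folner:
  assumes gen: "generating p" and "c > 0"
    and lo: "\<forall>\<^sub>F n in sequentially. c * ln (real n) \<le> green p n"
    and up: "\<forall>\<^sub>F n in sequentially. green p n \<le> C * ln (real n)"
  shows "AE \<omega> in M. folner_seq (\<lambda>n. walk_range X n \<omega>)"
proof -
  have rec: "\<exists>n. green p n > B" for B
  proof -
    have "\<forall>\<^sub>F n in sequentially. B < c * ln (real n)"
      using \<open>c > 0\<close> by (intro filterlim_at_top_dense[THEN iffD1, rule_format]) real_asymp
    with lo have "\<forall>\<^sub>F n in sequentially. B < green p n" by eventually_elim simp
    then show ?thesis by (auto simp: eventually_sequentially)
  qed
  have limit: "AE \<omega> in M. (\<lambda>n. real (card (bdry w (walk_range X n \<omega>))) / real (card (walk_range X n \<omega>))) \<longlonglongrightarrow> 0" for w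
  proof -
    define b where "b s = measure_pmf.expectation (replicate_pmf (s\<^sup>2) p) (\<lambda>xs. real (card (bdry w (path_range xs))))" for s
    obtain C1 where C1: "C1 > 0" "\<And>s. b s \<le> C1 * (real s + (real s / green p s)\<^sup>2)"
      using expectation_card_bdry_square_le[OF rec gen, of w] unfolding b_def by blast
    \<comment> \<open>For the boundary, \<open>s^2\<close> blocks of length \<open>s^2\<close> with
      \<open>s\<close> about \<open>n powr (1/4)\<close> cover nearly all of the first
      \<open>n\<close> steps. For the range, \<open>2 ^ k n\<close> is the last power of 2 up to
      \<open>n\<close>.\<close>
    define s where "s n = nat \<lfloor>real n powr (1/4)\<rfloor>" for n
    define k where "k n = nat \<lfloor>log 2 (real n)\<rfloor>" for n
    define K where "K m = nat \<lfloor>sqrt (real m)\<rfloor> + 1" for m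
    define L where "L m = 2 ^ m div K m" for m
    \<comment> \<open>Upper bound for the boundary: the mean, the Hoeffding deviation, and the
      \<open>n - s^4\<close> steps left over. The last are at most
      \<open>(s + 1)^4 - s^4 = 4 * s^3 + 6 * s^2 + 4 * s + 1\<close>, hence the constant 15.\<close>
    define U where "U n = C1 * ((real n powr (1/4))^3 + real n / (c * ln (real n powr (1/4) / 2))\<^sup>2)
        + (real n powr (1/4))^3 * sqrt (real n powr (1/4)) + 15 * (real n powr (1/4))^3" for n
    \<comment> \<open>The range will be at least \<open>n / D n\<close>. The factor 16 is the 4 of
      \<open>prob_small_range\<close> times 2 for replacing \<open>n\<close> by a power of 2 and 2
      for rounding down the block length; the square root counts the blocks, and
      \<open>C * ln n\<close> bounds the Green function.\<close>
    define D where "D n = 16 * (sqrt (log 2 (real n)) + 1) * (C * ln (real n))" for n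
    have s_lim: "filterlim s at_top sequentially" unfolding s_def by real_asymp
    have k_lim: "filterlim k at_top sequentially" unfolding k_def by real_asymp
    show ?thesis
      using AE_boundary_upper[of w] AE_range_lower
    proof eventually_elim
      case (elim \<omega>)
      have ev1: "\<forall>\<^sub>F n in sequentially. (\<Sum>j<(s n)\<^sup>2. real (card (bdry w (path_range (block X (j * (s n)\<^sup>2) ((s n)\<^sup>2) \<omega>)))))
          < (real (s n))\<^sup>2 * b (s n) + (real (s n))^3 * sqrt (real (s n))"
        using s_lim elim(1) unfolding b_def by (rule eventually_compose_filterlim[rotated])
      have ev2: "\<forall>\<^sub>F n in sequentially. \<exists>j<K (k n). real (L (k n)) \<le> 4 * green p (L (k n)) *
          real (card (path_range (block X (j * L (k n)) (L (k n)) \<omega>)))"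
        using k_lim elim(2) unfolding K_def L_def by (rule eventually_compose_filterlim[rotated])
      have ev3: "\<forall>\<^sub>F n in sequentially. c * ln (real (s n)) \<le> green p (s n)"
        using s_lim lo by (rule eventually_compose_filterlim[rotated])
      have ev4: "\<forall>\<^sub>F n in sequentially. 3 < real n powr (1/4)" by real_asymp
      have "\<forall>\<^sub>F m in sequentially. 2 * (sqrt (real m) + 1) \<le> 2 ^ m" by real_asymp
      then have ev5: "\<forall>\<^sub>F n in sequentially. 2 * (sqrt (real (k n)) + 1) \<le> 2 ^ k n"
        using k_lim by (rule eventually_compose_filterlim)
      have upper: "\<forall>\<^sub>F n in sequentially. real (card (bdry w (walk_range X n \<omega>))) \<le> U n"
        using ev1 ev3 ev4
      proof eventually_elim
        case (elim n)
        define y where "y = real n powr (1/4)"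
        define \<sigma> where "\<sigma> = s n"
        have y: "y > 3" using elim by (simp add: y_def)
        then have n0: "n > 0" by (cases n) (auto simp: y_def)
        have y4: "y ^ 4 = real n" using n0 by (simp add: y_def powr_power)
        have s1: "real \<sigma> \<le> y" "y < real \<sigma> + 1"
          using y unfolding \<sigma>_def s_def y_def by linarith+
        then have s2: "real \<sigma> \<ge> 1" using y by linarith
        have "real (\<sigma> ^ 4) \<le> y ^ 4" using power_mono[OF s1(1), of 4] by simp
        then have sn: "\<sigma>\<^sup>2 * \<sigma>\<^sup>2 \<le> n"
          unfolding y4 of_nat_le_iff by (simp add: power_add[symmetric])
        have rest: "real (n - \<sigma>\<^sup>2 * \<sigma>\<^sup>2) \<le> 15 * y ^ 3"
        proof -
          have "real (n - \<sigma>\<^sup>2 * \<sigma>\<^sup>2) = y ^ 4 - real \<sigma> ^ 4"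
            using sn y4 by (simp add: of_nat_diff power_add[symmetric])
          also have "\<dots> \<le> (real \<sigma> + 1) ^ 4 - real \<sigma> ^ 4"
            using s1 y by (intro diff_right_mono power_mono) auto
          also have "\<dots> = 4 * real \<sigma> ^ 3 + 6 * real \<sigma> ^ 2 + 4 * real \<sigma> + 1"
            by (simp add: power4_eq_xxxx power3_eq_cube power2_eq_square algebra_simps)
          also have "\<dots> \<le> 15 * real \<sigma> ^ 3"
          proof -
            have "real \<sigma> ^ 2 \<le> real \<sigma> ^ 3" using s2 by (intro power_increasing) auto
            moreover have "real \<sigma> ^ 1 \<le> real \<sigma> ^ 3" using s2 by (intro power_increasing) auto
            moreover have "1 \<le> real \<sigma> ^ 3" using s2 by (rule one_le_power)
            ultimately show ?thesis unfolding power_one_right by linarith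
          qed
          also have "\<dots> \<le> 15 * y ^ 3" using s1 by (simp add: power_mono)
          finally show ?thesis .
        qed
        \<comment> \<open>From \<open>y < real \<sigma> + 1\<close> and \<open>y > 3\<close> follows
          \<open>y / 2 \<le> real \<sigma>\<close>; halving replaces the rounding in
          \<open>s\<close> by an explicit function of \<open>n\<close>.\<close>
        have lny: "0 < c * ln (y / 2)" using y \<open>c > 0\<close> by simp
        have "c * ln (y / 2) \<le> c * ln (real \<sigma>)"
          using s1 s2 y \<open>c > 0\<close> by simp
        also have "\<dots> \<le> green p \<sigma>" using elim by (simp add: \<sigma>_def)
        finally have G: "c * ln (y / 2) \<le> green p \<sigma>" .
        have "(real \<sigma>)\<^sup>2 * b \<sigma> \<le> (real \<sigma>)\<^sup>2 * (C1 * (real \<sigma> + (real \<sigma> / green p \<sigma>)\<^sup>2))"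
          by (intro mult_left_mono C1) auto
        also have "\<dots> = C1 * (real \<sigma> ^ 3 + real \<sigma> ^ 4 / (green p \<sigma>)\<^sup>2)"
          by (simp add: power_divide algebra_simps eval_nat_numeral)
        also have "\<dots> \<le> C1 * (y ^ 3 + y ^ 4 / (c * ln (y / 2))\<^sup>2)"
          using C1 s1 G lny by (intro mult_left_mono add_mono power_mono frac_le) auto
        finally have bb: "(real \<sigma>)\<^sup>2 * b \<sigma> \<le> C1 * (y ^ 3 + y ^ 4 / (c * ln (y / 2))\<^sup>2)" .
        have dev: "real \<sigma> ^ 3 * sqrt (real \<sigma>) \<le> y ^ 3 * sqrt y"
          using s1 y by (intro mult_mono power_mono) auto
        have "real (card (bdry w (walk_range X n \<omega>))) \<le>
           real ((\<Sum>j<\<sigma>\<^sup>2. card (bdry w (path_range (block X (j * \<sigma>\<^sup>2) (\<sigma>\<^sup>2) \<omega>)))) + (n - \<sigma>\<^sup>2 * \<sigma>\<^sup>2))"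
          by (rule of_nat_mono, rule card_bdry_walk_range_le, rule sn)
        also have "\<dots> = (\<Sum>j<\<sigma>\<^sup>2. real (card (bdry w (path_range (block X (j * \<sigma>\<^sup>2) (\<sigma>\<^sup>2) \<omega>))))) + real (n - \<sigma>\<^sup>2 * \<sigma>\<^sup>2)"
          by (simp only: of_nat_add of_nat_sum)
        also have "\<dots> \<le> U n"
          using elim(1) bb[unfolded y4] dev rest unfolding U_def \<sigma>_def[symmetric] y_def[symmetric] by linarith
        finally show ?case .
      qed
      have lower: "\<forall>\<^sub>F n in sequentially. real n / D n \<le> real (card (walk_range X n \<omega>)) \<and> D n > 0 \<and> n > 0"
        using ev2 ev5 up eventually_gt_at_top[of 1]
      proof eventually_elim
        case (elim n)
        define m where "m = k n"
        have n1: "real n > 1" using elim by simp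
        have lg: "real m \<le> log 2 (real n)" "log 2 (real n) < real m + 1"
          using n1 unfolding m_def k_def by auto
        have m1: "2 ^ m \<le> real n"
          using lg(1) n1 by (subst (asm) le_log_iff) (auto simp: powr_realpow)
        have m2: "real n < 2 * 2 ^ m"
          using lg(2) n1 by (subst (asm) log_less_iff) (auto simp: powr_realpow powr_add)
        have K1: "real (K m) \<le> sqrt (real m) + 1" "K m > 0" by (auto simp: K_def)
        \<comment> \<open>Rounding down loses at most 1, which is at most half of
          \<open>2 ^ m / K m\<close> once \<open>2 * K m \<le> 2 ^ m\<close>.\<close>
        have Lm: "2 ^ m / (2 * real (K m)) \<le> real (L m)"
        proof -
          have "real (2 ^ m) / real (K m) - 1 \<le> real (L m)"
            unfolding L_def using floor_divide_of_nat_eq[of "2 ^ m" "K m", where 'a = real] by linarith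
          moreover have "2 * real (K m) \<le> 2 ^ m" using K1 elim(2) by (simp add: m_def)
          then have "1 \<le> 2 ^ m / (2 * real (K m))" using K1 by simp
          moreover have "real (2 ^ m) / real (K m) = 2 * (2 ^ m / (2 * real (K m)))" using K1 by simp
          ultimately show ?thesis by linarith
        qed
        have "L m * K m \<le> 2 ^ m" unfolding L_def by simp
        moreover have "2 ^ m \<le> n" using m1 by (metis of_nat_le_iff of_nat_numeral of_nat_power)
        ultimately have KL: "K m * L m \<le> n" by (simp add: mult.commute)
        have Ln: "L m \<le> n"
        proof -
          have "L m \<le> K m * L m" using K1(2) by simp
          then show ?thesis using KL by (rule le_trans)
        qed
        obtain j where j: "j < K m" "real (L m) \<le> 4 * green p (L m) * real (card (path_range (block X (j * L m) (L m) \<omega>)))"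
          using elim(1) by (auto simp: m_def)
        have G: "green p (L m) \<le> C * ln (real n)" "1 \<le> C * ln (real n)"
          using green_mono[OF Ln, of p] green_ge_1[of p n] elim(3) by linarith+
        have "real (L m) \<le> 4 * green p (L m) * real (card (path_range (block X (j * L m) (L m) \<omega>)))" by (rule j)
        also have "\<dots> \<le> 4 * (C * ln (real n)) * real (card (walk_range X n \<omega>))"
          using card_path_range_block_le[OF j(1) KL, of X \<omega>] G green_ge_1[of p "L m"]
          by (intro mult_mono) auto
        finally have c1: "2 ^ m / (2 * real (K m)) \<le> 4 * (C * ln (real n)) * real (card (walk_range X n \<omega>))"
          using Lm by linarith
        have "real n / (2 * (2 * (sqrt (log 2 (real n)) + 1))) \<le> 2 ^ m / (2 * real (K m))"
        proof -
          have "real (K m) \<le> sqrt (log 2 (real n)) + 1"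
            using K1(1) real_sqrt_le_mono[OF lg(1)] by linarith
          then have "(real n / 2) / (2 * (sqrt (log 2 (real n)) + 1)) \<le> 2 ^ m / (2 * real (K m))"
            using m2 K1 n1 by (intro frac_le) auto
          then show ?thesis by simp
        qed
        with c1 have c2: "real n / (2 * (2 * (sqrt (log 2 (real n)) + 1))) \<le> 4 * (C * ln (real n)) * real (card (walk_range X n \<omega>))"
          by linarith
        have sq: "sqrt (log 2 (real n)) \<ge> 0" using n1 by simp
        have "0 < 16 * (sqrt (log 2 (real n)) + 1)"
          by (rule mult_pos_pos[OF _ add_nonneg_pos[OF sq zero_less_one]]) simp
        moreover have "0 < C * ln (real n)" using G(2) by linarith
        ultimately have D0: "D n > 0" unfolding D_def by (rule mult_pos_pos)
        have "real n \<le> (4 * (C * ln (real n)) * real (card (walk_range X n \<omega>))) * (2 * (2 * (sqrt (log 2 (real n)) + 1)))"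
        proof -
          have "0 < 2 * (2 * (sqrt (log 2 (real n)) + 1))"
            by (intro mult_pos_pos add_nonneg_pos[OF sq zero_less_one]) simp_all
          from c2[unfolded pos_divide_le_eq[OF this]] show ?thesis .
        qed
        also have "\<dots> = real (card (walk_range X n \<omega>)) * D n" by (simp add: D_def algebra_simps)
        finally show ?case using D0 n1 by (simp add: pos_divide_le_eq)
      qed
      \<comment> \<open>Only the second limit is close: it is of order
        \<open>ln n powr (3/2) / (ln n)^2\<close>. In the other two a power of \<open>n\<close> is
        to spare, namely \<open>n powr (1/4)\<close> and \<open>n powr (1/8)\<close>.\<close>
      have "(\<lambda>n. U n * D n / real n) \<longlonglongrightarrow> 0"
      proof -
        have 1: "(\<lambda>n. (real n powr (1/4))^3 * ((sqrt (log 2 (real n)) + 1) * ln (real n)) / real n) \<longlonglongrightarrow> 0"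
          by real_asymp
        have 2: "(\<lambda>n. (1 / (ln (real n powr (1/4) / 2))\<^sup>2) * ((sqrt (log 2 (real n)) + 1) * ln (real n))) \<longlonglongrightarrow> 0"
          by real_asymp
        have 3: "(\<lambda>n. (real n powr (1/4))^3 * sqrt (real n powr (1/4)) * ((sqrt (log 2 (real n)) + 1) * ln (real n)) / real n) \<longlonglongrightarrow> 0"
          by real_asymp
        have "(\<lambda>n. (C1 + 15) * 16 * C * ((real n powr (1/4))^3 * ((sqrt (log 2 (real n)) + 1) * ln (real n)) / real n)
           + C1 * 16 * C / c\<^sup>2 * ((1 / (ln (real n powr (1/4) / 2))\<^sup>2) * ((sqrt (log 2 (real n)) + 1) * ln (real n)))
           + 16 * C * ((real n powr (1/4))^3 * sqrt (real n powr (1/4)) * ((sqrt (log 2 (real n)) + 1) * ln (real n)) / real n))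
           \<longlonglongrightarrow> (C1 + 15) * 16 * C * 0 + C1 * 16 * C / c\<^sup>2 * 0 + 16 * C * 0"
          by (intro tendsto_add tendsto_mult_left 1 2 3)
        moreover have "\<forall>\<^sub>F n in sequentially. (C1 + 15) * 16 * C * ((real n powr (1/4))^3 * ((sqrt (log 2 (real n)) + 1) * ln (real n)) / real n)
           + C1 * 16 * C / c\<^sup>2 * ((1 / (ln (real n powr (1/4) / 2))\<^sup>2) * ((sqrt (log 2 (real n)) + 1) * ln (real n)))
           + 16 * C * ((real n powr (1/4))^3 * sqrt (real n powr (1/4)) * ((sqrt (log 2 (real n)) + 1) * ln (real n)) / real n)
           = U n * D n / real n"
          using eventually_gt_at_top[of 0]
        proof eventually_elim
          case (elim n)
          then have n0: "real n \<noteq> 0" by simp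
          define y3 q l y2 where "y3 = (real n powr (1/4))^3" and "q = sqrt (log 2 (real n)) + 1" and "l = ln (real n)"
            and "y2 = ln (real n powr (1/4) / 2)"
          have "U n * D n / real n = (C1 * (y3 + real n / (c * y2)\<^sup>2) + y3 * sqrt (real n powr (1/4)) + 15 * y3) * (16 * q * (C * l)) / real n"
            by (simp add: U_def D_def y3_def q_def l_def y2_def)
          also have "\<dots> = (C1 + 15) * 16 * C * (y3 * (q * l) / real n) + C1 * 16 * C / c\<^sup>2 * (1 / y2\<^sup>2 * (q * l))
              + 16 * C * (y3 * sqrt (real n powr (1/4)) * (q * l) / real n)"
          proof -
            define v t N where "v = 1 / (c * y2)\<^sup>2" and "t = sqrt (real n powr (1/4))" and "N = real n"
            have "(C1 * (y3 + N * v) + y3 * t + 15 * y3) * (16 * q * (C * l)) / N =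
              (C1 + 15) * 16 * C * (y3 * (q * l) / N) + C1 * 16 * C * v * (q * l) + 16 * C * (y3 * t * (q * l) / N)"
              using n0 unfolding N_def[symmetric] by (simp add: field_simps)
            then show ?thesis by (simp add: v_def t_def N_def power_mult_distrib)
          qed
          finally show ?case unfolding y3_def q_def l_def y2_def by simp
        qed
        ultimately show ?thesis by (auto elim: Lim_transform_eventually)
      qed
      then show ?case
      proof (rule Lim_null_comparison[rotated])
        show "\<forall>\<^sub>F n in sequentially. norm (real (card (bdry w (walk_range X n \<omega>))) / real (card (walk_range X n \<omega>))) \<le> U n * D n / real n"
          using upper lower
        proof eventually_elim
          case (elim n)
          have "real (card (bdry w (walk_range X n \<omega>))) / real (card (walk_range X n \<omega>)) \<le> U n / (real n / D n)"
            using elim by (intro frac_le) auto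
          then show ?case by simp
        qed
      qed
    qed
  qed
  \<comment> \<open>The lattice is countable, so the exceptional null sets for the individual
    \<open>w\<close> can be united.\<close>
  have "AE \<omega> in M. \<forall>w. (\<lambda>n. real (card (bdry w (walk_range X n \<omega>))) / real (card (walk_range X n \<omega>))) \<longlonglongrightarrow> 0"
    using limit by (subst AE_all_countable) blast
  then show ?thesis
  proof eventually_elim
    case (elim \<omega>)
    have "(\<lambda>n. real (card (sym_diff (walk_range X n \<omega>) ((\<lambda>x. x + w) ` walk_range X n \<omega>))) / real (card (walk_range X n \<omega>))) \<longlonglongrightarrow> 0" for w
    proof -
      have "(\<lambda>n. 2 * (real (card (bdry w (walk_range X n \<omega>))) / real (card (walk_range X n \<omega>)))) \<longlonglongrightarrow> 2 * 0"
        using elim by (intro tendsto_mult_left) blast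
      then show ?thesis by (simp add: card_sym_diff_translate)
    qed
    moreover have "finite (walk_range X n \<omega>) \<and> walk_range X n \<omega> \<noteq> {}" if "n \<ge> 1" for n
      using that by (auto simp: walk_range_def)
    ultimately show ?case unfolding folner_seq_def by blast
  qed
qed

end

section \<open>Averaging over the torus\<close>

definition circle :: "real measure" where
  "circle = uniform_measure lborel {-pi..pi}"

text \<open>Normalised Haar measure on the torus, taken on functions so that integrals of products
  factor; \<open>angles\<close> passes to the vectors on which the symbol is defined.\<close>

definition torus :: "('n :: finite \<Rightarrow> real) measure" where
  "torus = PiM UNIV (\<lambda>_. circle)"

lemma prob_space_circle: "prob_space circle"
  unfolding circle_def by (rule prob_space_uniform_measure) auto

lemma sets_circle [measurable_cong, simp]: "sets circle = sets borel"
  by (simp add: circle_def)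

lemma finite_product_prob_space_circle: "finite_product_prob_space (\<lambda>_. circle) (UNIV :: 'n :: finite set)"
  using prob_space_circle
  by (auto simp: finite_product_prob_space_def product_prob_space_def product_prob_space_axioms_def
      product_sigma_finite_def finite_product_sigma_finite_def finite_product_sigma_finite_axioms_def
      intro: prob_space_imp_sigma_finite)

lemma prob_space_torus: "prob_space (torus :: ('n :: finite \<Rightarrow> real) measure)"
  unfolding torus_def by (rule prob_space_PiM) (rule prob_space_circle)

lemma integral_circle_iexp: "(CLINT u|circle. iexp (u * real_of_int k)) = of_bool (k = 0)"
proof (cases "k = 0")
  case True
  then show ?thesis using prob_space.prob_space[OF prob_space_circle] by simp
next
  case False
  have eq: "circle = density lborel (\<lambda>u. ennreal (indicator {-pi..pi} u / (2 * pi)))"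
    unfolding circle_def uniform_measure_def
    by (intro density_cong) (auto simp: indicator_def divide_ennreal[symmetric] ennreal_1[symmetric] simp del: ennreal_1)
  have "(CLINT u|circle. iexp (u * real_of_int k)) = (CLINT u|lborel. (indicator {-pi..pi} u / (2 * pi)) *\<^sub>R iexp (u * real_of_int k))"
    unfolding eq by (rule integral_density) (auto simp: indicator_def)
  also have "\<dots> = (CLINT u|lborel. (1 / (2 * pi)) *\<^sub>R (indicator {-pi..pi} u *\<^sub>R iexp (u * real_of_int k)))"
    by (intro Bochner_Integration.integral_cong) auto
  also have "\<dots> = (1 / (2 * pi)) *\<^sub>R (CLINT u|lborel. indicator {-pi..pi} u *\<^sub>R iexp (u * real_of_int k))"
    by (rule integral_scaleR_right)
  also have "(CLINT u|lborel. indicator {-pi..pi} u *\<^sub>R iexp (u * real_of_int k)) = (CLBINT u=-pi..pi. iexp (u * real_of_int k))"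
    by (subst interval_integral_Icc) (auto simp: set_lebesgue_integral_def)
  also have "\<dots> = (- \<i> / of_int k) * iexp (pi * real_of_int k) - (- \<i> / of_int k) * iexp ((- pi) * real_of_int k)"
    using False
    by (intro interval_integral_FTC_finite)
       (auto intro!: continuous_intros derivative_eq_intros simp: has_vector_derivative_complex_iff Re_exp Im_exp)
  also have "iexp (pi * real_of_int k) = iexp ((- pi) * real_of_int k)"
    by (subst exp_eq) (auto intro!: exI[of _ k] simp: algebra_simps)
  finally show ?thesis using False by simp
qed

definition angles :: "('n :: finite \<Rightarrow> real) \<Rightarrow> real ^ 'n" where
  "angles f = (\<chi> i. f i)"

lemma angles_nth [simp]: "angles f $ i = f i"
  by (simp add: angles_def)

lemma measurable_torus_component [measurable]: "(\<lambda>f. f i) \<in> borel_measurable (torus :: ('n :: finite \<Rightarrow> real) measure)"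
proof -
  have "(\<lambda>f. f i) \<in> measurable (torus :: ('n \<Rightarrow> real) measure) circle"
    unfolding torus_def by measurable
  then show ?thesis by (simp cong: measurable_cong_sets)
qed

lemma angles_inner: "angles f \<bullet> rvec x = (\<Sum>i\<in>UNIV. f i * real_of_int (x $ i))"
  by (simp add: inner_vec_def rvec_def)

lemma measurable_angles [measurable]: "angles \<in> borel_measurable (torus :: ('n :: finite \<Rightarrow> real) measure)"
  by (subst borel_measurable_euclidean_space) (auto simp: Basis_vec_def inner_axis)

text \<open>Orthogonality of characters: the exponential of the inner product factors over the
  coordinates, and each circle average vanishes unless its frequency is 0.\<close>

lemma integral_torus_iexp:
  "(CLINT f|torus. iexp (angles f \<bullet> rvec x)) = of_bool (x = (0 :: int ^ 'n))"
proof -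
  interpret torus: finite_product_prob_space "\<lambda>_. circle" "UNIV :: 'n set"
    by (rule finite_product_prob_space_circle)
  have "(CLINT f|torus. iexp (angles f \<bullet> rvec x)) =
        (CLINT f|Pi\<^sub>M UNIV (\<lambda>_. circle). (\<Prod>i\<in>(UNIV :: 'n set). iexp (f i * real_of_int (x $ i))))"
    unfolding torus_def angles_inner by (simp add: sum_distrib_left exp_sum)
  also have "\<dots> = (\<Prod>i\<in>(UNIV :: 'n set). CLINT u|circle. iexp (u * real_of_int (x $ i)))"
  proof (rule torus.product_integral_prod)
    fix i :: 'n
    show "complex_integrable circle (\<lambda>u. iexp (u * real_of_int (x $ i)))"
      by (rule finite_measure.integrable_const_bound[where B = 1])
         (auto simp: prob_space.finite_measure[OF prob_space_circle] measurable_cong_sets[OF sets_circle refl])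
  qed simp
  also have "\<dots> = of_bool (x = 0)"
    unfolding integral_circle_iexp by (auto simp: vec_eq_iff of_bool_def)
  finally show ?thesis .
qed

lemma measure_circle_interval:
  assumes "0 \<le> s" "s \<le> pi"
  shows "measure circle {-s..s} = s / pi"
proof -
  have "{-pi..pi} \<inter> {-s..s} = {-s..s}" using assms by auto
  then show ?thesis unfolding circle_def using assms by simp
qed

lemma measure_torus_box:
  assumes "0 \<le> s" "s \<le> pi"
  shows "measure torus {f :: 'n :: finite \<Rightarrow> real. \<forall>i. \<bar>f i\<bar> \<le> s} = (s / pi) ^ CARD('n)"
proof -
  interpret torus: finite_product_prob_space "\<lambda>_. circle" "UNIV :: 'n set"
    by (rule finite_product_prob_space_circle)
  have "{f :: 'n \<Rightarrow> real. \<forall>i. \<bar>f i\<bar> \<le> s} = PiE UNIV (\<lambda>_. {-s..s})"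
    by (auto simp: PiE_def abs_le_iff minus_le_iff)
  then have "measure torus {f :: 'n \<Rightarrow> real. \<forall>i. \<bar>f i\<bar> \<le> s} = (\<Prod>i\<in>(UNIV :: 'n set). measure circle {-s..s})"
    unfolding torus_def by (simp add: torus.prob_times)
  then show ?thesis using assms by (simp add: measure_circle_interval)
qed

lemma AE_torus_box: "AE f in (torus :: ('n :: finite \<Rightarrow> real) measure). \<forall>i. \<bar>f i\<bar> \<le> pi"
proof -
  interpret t: prob_space "torus :: ('n \<Rightarrow> real) measure" by (rule prob_space_torus)
  have sp: "space torus = (UNIV :: ('n \<Rightarrow> real) set)"
    by (simp add: torus_def space_PiM circle_def)
  have "measure torus {f \<in> space torus. \<forall>i :: 'n. \<bar>f i\<bar> \<le> pi} = 1"
    using measure_torus_box[of pi, where 'n = 'n] by (simp add: sp)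
  moreover have "{f \<in> space torus. \<forall>i :: 'n. \<bar>f i\<bar> \<le> pi} \<in> sets torus" by measurable
  ultimately show ?thesis using t.prob_Collect_eq_1[of "\<lambda>f. \<forall>i. \<bar>f i\<bar> \<le> pi"] by blast
qed

text \<open>With \<open>r\<close> the root of \<open>s\<close> of order \<open>d\<close>, the ball
  of radius \<open>r\<close> lies between the cubes of half side \<open>r / d\<close> and
  \<open>r\<close>; \<open>s \<le> 1\<close> keeps both cubes inside the torus. Thus
  \<open>norm t ^ d\<close> is distributed near 0 like a uniform variable up to constants, whatever
  \<open>d\<close> is, and this makes the integral of \<open>1 / (\<epsilon> + norm t ^ d)\<close>
  logarithmic in every dimension.\<close>

lemma measure_torus_norm_power:
  fixes s :: real
  assumes s: "0 \<le> s" "s \<le> 1"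
  shows "(1 / (real CARD('n) * pi)) ^ CARD('n) * s \<le> measure torus {f :: 'n :: finite \<Rightarrow> real. norm (angles f) ^ CARD('n) \<le> s}"
    and "measure torus {f :: 'n :: finite \<Rightarrow> real. norm (angles f) ^ CARD('n) \<le> s} \<le> s"
proof -
  interpret t: prob_space "torus :: ('n \<Rightarrow> real) measure" by (rule prob_space_torus)
  let ?d = "CARD('n)"
  let ?A = "{f :: 'n \<Rightarrow> real. norm (angles f) ^ ?d \<le> s}"
  define r where "r = root ?d s"
  have d: "?d \<ge> 1" by (simp add: Suc_leI)
  have rs: "r ^ ?d = s" unfolding r_def using s by (intro real_root_pow_pos2) auto
  have r: "0 \<le> r" "r \<le> 1" using s by (auto simp: r_def)
  have mem: "f \<in> ?A \<longleftrightarrow> norm (angles f) \<le> r" for f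
    unfolding mem_Collect_eq rs[symmetric] using r by (intro power_mono_iff) auto
  have sp: "space torus = (UNIV :: ('n \<Rightarrow> real) set)"
    by (simp add: torus_def space_PiM circle_def)
  have box [measurable]: "{f :: 'n \<Rightarrow> real. \<forall>i. \<bar>f i\<bar> \<le> q} \<in> sets torus" for q
  proof -
    have "{f \<in> space torus. \<forall>i :: 'n. \<bar>f i\<bar> \<le> q} \<in> sets torus" by measurable
    then show ?thesis by (simp add: sp)
  qed
  have A: "?A \<in> sets torus"
  proof -
    have "{f \<in> space torus. norm (angles f :: real ^ 'n) ^ ?d \<le> s} \<in> sets torus" by measurable
    then show ?thesis by (simp add: sp)
  qed
  have "(1 / (real ?d * pi)) ^ ?d * s = ((r / real ?d) / pi) ^ ?d"
    by (simp add: power_divide power_mult_distrib rs)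
  also have "\<dots> = measure torus {f :: 'n \<Rightarrow> real. \<forall>i. \<bar>f i\<bar> \<le> r / real ?d}"
  proof (rule measure_torus_box[symmetric])
    have "r / real ?d \<le> r / 1" using r d by (intro divide_left_mono) auto
    then show "r / real ?d \<le> pi" using r pi_gt3 by simp
  qed (use r in auto)
  also have "\<dots> \<le> measure torus ?A"
  proof (rule t.finite_measure_mono[OF _ A], safe)
    fix f :: "'n \<Rightarrow> real"
    assume f: "\<forall>i. \<bar>f i\<bar> \<le> r / real ?d"
    have "norm (angles f) \<le> (\<Sum>i\<in>UNIV. \<bar>angles f $ i\<bar>)" by (rule norm_le_l1_cart)
    also have "\<dots> \<le> (\<Sum>i\<in>(UNIV :: 'n set). r / real ?d)" using f by (intro sum_mono) auto
    also have "\<dots> = r" by simp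
    finally show "norm (angles f) ^ ?d \<le> s" using mem by simp
  qed
  finally show "(1 / (real ?d * pi)) ^ ?d * s \<le> measure torus ?A" .
  have "measure torus ?A \<le> measure torus {f :: 'n \<Rightarrow> real. \<forall>i. \<bar>f i\<bar> \<le> r}"
  proof (rule t.finite_measure_mono[OF _ box], safe)
    fix f :: "'n \<Rightarrow> real" and i
    assume "norm (angles f) ^ ?d \<le> s"
    then have "norm (angles f) \<le> r" using mem by simp
    then show "\<bar>f i\<bar> \<le> r" using component_le_norm_cart[of "angles f" i] by simp
  qed
  also have "\<dots> = (r / pi) ^ ?d"
    using r pi_gt3 by (intro measure_torus_box) auto
  also have "\<dots> \<le> r ^ ?d"
  proof (rule power_mono)
    have "r / pi \<le> r / 1" using r pi_gt3 by (intro divide_left_mono) auto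
    then show "r / pi \<le> r" by simp
  qed (use r in auto)
  finally show "measure torus ?A \<le> s" by (simp add: rs)
qed

section \<open>Logarithmic growth of the Green function from the symbol\<close>

text \<open>If \<open>h \<le> 1\<close> and \<open>i\<close> is the largest index up to
  \<open>J\<close> with \<open>h \<le> (1 / 2) ^ i\<close>, then \<open>S = 2 * 2 ^ i - 1\<close>,
  and the fraction lies between \<open>2 ^ i / 2\<close> and \<open>2 * 2 ^ i\<close>. If
  \<open>h > 1\<close>, then \<open>S = 0\<close>, and the summand 1 in the upper bound takes
  over.\<close>

lemma dyadic_layers:
  fixes h :: real and J :: nat
  assumes h: "h \<ge> 0"
  defines "S \<equiv> (\<Sum>j\<le>J. 2 ^ j * of_bool (h \<le> (1 / 2) ^ j))"
  shows "S / 4 \<le> 1 / ((1 / 2) ^ J + h)" and "1 / ((1 / 2) ^ J + h) \<le> 2 * S + 1"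
proof -
  have e0: "(1 / 2 :: real) ^ J > 0" by simp
  have "S / 4 \<le> 1 / ((1 / 2) ^ J + h) \<and> 1 / ((1 / 2) ^ J + h) \<le> 2 * S + 1"
  proof (cases "h \<le> 1")
    case False
    then have "\<not> h \<le> (1 / 2) ^ j" for j :: nat using power_le_one[of "1/2 :: real" j] by simp
    then have "S = 0" by (simp add: S_def)
    moreover have "1 \<le> (1 / 2) ^ J + h" using False e0 by linarith
    ultimately show ?thesis by (simp add: divide_le_eq)
  next
    case True
    define I where "I = {j. j \<le> J \<and> h \<le> (1 / 2) ^ j}"
    define i where "i = Max I"
    have I: "finite I" "0 \<in> I" using True by (auto simp: I_def)
    then have iI: "i \<in> I" unfolding i_def by (intro Max_in) auto
    have imax: "j \<le> i" if "j \<in> I" for j unfolding i_def using that I by auto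
    have "I = {..i}"
    proof (intro equalityI subsetI)
      fix j assume "j \<in> {..i}"
      then have "(1 / 2 :: real) ^ i \<le> (1 / 2) ^ j" by (intro power_decreasing) auto
      then have "h \<le> (1 / 2) ^ j" using iI order_trans unfolding I_def by blast
      then show "j \<in> I" using iI \<open>j \<in> {..i}\<close> by (auto simp: I_def)
    qed (use imax in auto)
    have "S = (\<Sum>j\<in>I. 2 ^ j)"
      unfolding S_def by (rule sum.mono_neutral_cong_right) (auto simp: I_def)
    also have "\<dots> = (\<Sum>j<Suc i. 2 ^ j)" using \<open>I = {..i}\<close> by (simp add: lessThan_Suc_atMost)
    also have "\<dots> = 2 * 2 ^ i - 1" by (subst geometric_sum) auto
    finally have S: "S = 2 * 2 ^ i - 1" .
    have hi: "h \<le> (1 / 2) ^ i" and iJ: "i \<le> J" using iI by (auto simp: I_def)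
    have eJ: "(1 / 2 :: real) ^ J \<le> (1 / 2) ^ i" using iJ by (intro power_decreasing) auto
    have pos: "(1 / 2 :: real) ^ i > 0" by simp
    have inv: "2 ^ i = 1 / (1 / 2 :: real) ^ i" by (simp add: power_one_over)
    have "S / 4 \<le> 2 ^ i / 2" using S by simp
    also have "\<dots> = 1 / ((1 / 2) ^ i + (1 / 2) ^ i)" unfolding inv by simp
    also have "\<dots> \<le> 1 / ((1 / 2) ^ J + h)"
    proof (rule divide_left_mono)
      show "(1 / 2) ^ J + h \<le> (1 / 2) ^ i + (1 / 2) ^ i" using hi eJ by linarith
      show "0 < ((1 / 2) ^ i + (1 / 2) ^ i) * ((1 / 2) ^ J + h)" using e0 h pos by (intro mult_pos_pos) linarith+
    qed simp
    finally have low: "S / 4 \<le> 1 / ((1 / 2) ^ J + h)" .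
    have "(1 / 2) ^ i / 2 \<le> (1 / 2) ^ J + h"
    proof (cases "i = J")
      case True
      then show ?thesis using h pos by simp
    next
      case False
      then have "Suc i \<notin> I" "Suc i \<le> J" using imax[of "Suc i"] iJ by auto
      then have "h > (1 / 2) ^ Suc i" by (auto simp: I_def)
      then have "h > (1 / 2) ^ i / 2" by simp
      then show ?thesis using e0 by linarith
    qed
    then have "1 / ((1 / 2) ^ J + h) \<le> 1 / ((1 / 2) ^ i / 2)"
      using pos add_pos_nonneg[OF e0 h] by (intro divide_left_mono) (auto simp: mult_pos_pos)
    also have "\<dots> = 2 * 2 ^ i" unfolding inv by simp
    also have "\<dots> \<le> 2 * S + 1" using S one_le_power[of "2 :: real" i] by linarith
    finally show ?thesis using low by simp
  qed
  then show "S / 4 \<le> 1 / ((1 / 2) ^ J + h)" "1 / ((1 / 2) ^ J + h) \<le> 2 * S + 1" by auto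
qed

text \<open>The logarithm appears as a number of layers: each of the \<open>J + 1\<close> scales
  contributes \<open>2 ^ j * prob {h \<le> (1 / 2) ^ j}\<close>, which lies between \<open>a\<close>
  and 1.\<close>

lemma (in prob_space) integral_dyadic:
  fixes h :: "'a \<Rightarrow> real"
  assumes [measurable]: "h \<in> borel_measurable M" and h: "\<And>x. h x \<ge> 0"
    and lo: "\<And>j. a * (1 / 2) ^ j \<le> prob {x \<in> space M. h x \<le> (1 / 2) ^ j}"
    and up: "\<And>j. prob {x \<in> space M. h x \<le> (1 / 2) ^ j} \<le> (1 / 2) ^ j"
  shows "integrable M (\<lambda>x. 1 / ((1 / 2) ^ J + h x))"
    and "a / 4 * (real J + 1) \<le> expectation (\<lambda>x. 1 / ((1 / 2) ^ J + h x))"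
    and "expectation (\<lambda>x. 1 / ((1 / 2) ^ J + h x)) \<le> 2 * (real J + 1) + 1"
proof -
  let ?f = "\<lambda>x. 1 / ((1 / 2) ^ J + h x)"
  define A where "A j = {x \<in> space M. h x \<le> (1 / 2) ^ j}" for j :: nat
  define S where "S x = (\<Sum>j\<le>J. 2 ^ j * indicator (A j) x :: real)" for x
  have A [measurable]: "A j \<in> sets M" for j unfolding A_def by measurable
  have S: "S x = (\<Sum>j\<le>J. 2 ^ j * of_bool (h x \<le> (1 / 2) ^ j))" if "x \<in> space M" for x
    using that by (simp add: S_def A_def indicator_def)
  have intA: "integrable M (\<lambda>x. 2 ^ j * indicator (A j) x :: real)" for j
    by (intro integrable_mult_right integrable_real_indicator) (auto simp: less_top[symmetric])
  have intS: "integrable M S" unfolding S_def by (intro Bochner_Integration.integrable_sum intA)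
  have ES: "expectation S = (\<Sum>j\<le>J. 2 ^ j * prob (A j))"
    unfolding S_def by (subst Bochner_Integration.integral_sum) (use intA in simp_all)
  show int: "integrable M ?f"
  proof (rule integrable_const_bound[where B = "2 ^ J"])
    show "AE x in M. norm (?f x) \<le> 2 ^ J"
    proof (rule AE_I2)
      fix x
      have "1 / ((1 / 2) ^ J + h x) \<le> 1 / (1 / 2) ^ J"
        using h[of x] by (intro divide_left_mono) (auto simp: add_pos_nonneg)
      then show "norm (?f x) \<le> 2 ^ J" using h[of x] by (simp add: power_one_over)
    qed
  qed measurable
  have "a / 4 * (real J + 1) = (\<Sum>j\<le>J. 2 ^ j * (a * (1 / 2) ^ j)) / 4"
    by (simp add: power_one_over mult.commute)
  also have "\<dots> \<le> expectation S / 4"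
    unfolding ES A_def using lo by (intro divide_right_mono sum_mono mult_left_mono) auto
  also have "\<dots> = expectation (\<lambda>x. S x / 4)" by simp
  also have "\<dots> \<le> expectation ?f"
      proof (rule integral_mono)
    fix x assume "x \<in> space M"
    from S[OF this] show "S x / 4 \<le> ?f x" by (simp only: dyadic_layers(1)[OF h])
  qed (use int intS in simp_all)
  finally show "a / 4 * (real J + 1) \<le> expectation ?f" .
  have "expectation ?f \<le> expectation (\<lambda>x. 2 * S x + 1)"
      proof (rule integral_mono)
    fix x assume "x \<in> space M"
    from S[OF this] show "?f x \<le> 2 * S x + 1" by (simp only: dyadic_layers(2)[OF h])
  qed (use int intS in simp_all)
  also have "\<dots> = 2 * expectation S + 1" using intS by (simp add: prob_space)
  also have "expectation S \<le> (\<Sum>j\<le>J. 2 ^ j * (1 / 2) ^ j)"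
    unfolding ES A_def using up by (intro sum_mono mult_left_mono) auto
  also have "\<dots> = real J + 1" by (simp add: power_mult_distrib[symmetric])
  finally show "expectation ?f \<le> 2 * (real J + 1) + 1" by simp
qed

text \<open>Abel summation turns the sequence \<open>q k = \<integral> \<phi> ^ k\<close> into \<open>\<integral> 1 / (1 - r \<phi>)\<close> with \<open>r = 1 - (1 / 2) ^ J\<close>.
  When \<open>1 - \<phi>\<close> is comparable to \<open>h\<close>, so is this integral to that of \<open>1 / ((1 / 2) ^ J + h)\<close>.\<close>

lemma (in prob_space) abel_sum_bounds:
  fixes \<phi> :: "'a \<Rightarrow> complex" and q :: "nat \<Rightarrow> real"
  assumes [measurable]: "\<phi> \<in> borel_measurable M" "h \<in> borel_measurable M"
    and q: "\<And>k. complex_of_real (q k) = (CLINT x|M. \<phi> x ^ k)"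
    and h: "\<And>x. h x \<ge> 0"
    and "m > 0" "m \<le> 1" "K \<ge> 1"
    and sym: "AE x in M. 2 * m * h x \<le> Re (1 - \<phi> x) \<and> cmod (1 - \<phi> x) \<le> K * h x \<and> cmod (\<phi> x) \<le> 1"
    and lo: "\<And>j. a * (1 / 2) ^ j \<le> prob {x \<in> space M. h x \<le> (1 / 2) ^ j}"
    and up: "\<And>j. prob {x \<in> space M. h x \<le> (1 / 2) ^ j} \<le> (1 / 2) ^ j"
    and J: "J \<ge> 1"
  shows "m / K\<^sup>2 * (a / 4 * (real J + 1)) \<le> (\<Sum>k. (1 - (1 / 2) ^ J) ^ k * q k)"
    and "(\<Sum>k. (1 - (1 / 2) ^ J) ^ k * q k) \<le> 1 / m * (2 * (real J + 1) + 1)"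
proof -
  define \<epsilon> where "\<epsilon> = (1 / 2 :: real) ^ J"
  define r where "r = 1 - \<epsilon>"
  have \<epsilon>: "0 < \<epsilon>" "\<epsilon> \<le> 1 / 2" using J power_decreasing[of 1 J "1 / 2 :: real"] by (auto simp: \<epsilon>_def)
  then have r: "1 / 2 \<le> r" "r < 1" "0 < r" by (auto simp: r_def)
  define z where "z x = 1 - of_real r * \<phi> x" for x
  have le1: "AE x in M. cmod (\<phi> x) \<le> 1" using sym by eventually_elim simp
  have bd: "AE x in M. norm ((of_real r * \<phi> x) ^ k) \<le> r ^ k" for k
    using le1
  proof eventually_elim
    case (elim x)
    then have "norm (of_real r * \<phi> x) \<le> r" using r by (simp add: norm_mult mult_left_le)
    then show ?case unfolding norm_power by (rule power_mono) simp
  qed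
  have int: "integrable M (\<lambda>x. (of_real r * \<phi> x) ^ k)" for k
    using bd by (intro integrable_const_bound[where B = "r ^ k"]) auto
  have geo: "summable (\<lambda>k. r ^ k)" using r by (intro summable_geometric) auto
  have intk: "(CLINT x|M. (of_real r * \<phi> x) ^ k) = of_real (r ^ k * q k)" for k
    by (simp add: power_mult_distrib q)
  have sumnorm: "AE x in M. summable (\<lambda>k. norm ((of_real r * \<phi> x) ^ k))"
  proof -
    have "AE x in M. \<forall>k. norm ((of_real r * \<phi> x) ^ k) \<le> r ^ k" using bd by (subst AE_all_countable) blast
    then show ?thesis by eventually_elim (rule summable_comparison_test[OF _ geo], auto)
  qed
  have sumint: "summable (\<lambda>k. \<integral>x. norm ((of_real r * \<phi> x) ^ k) \<partial>M)"
  proof (rule summable_comparison_test[OF _ geo], intro exI allI impI)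
    fix k
    have "(\<integral>x. norm ((of_real r * \<phi> x) ^ k) \<partial>M) \<le> (\<integral>x. r ^ k \<partial>M)"
      using int bd by (intro integral_mono_AE) auto
    then show "norm (\<integral>x. norm ((of_real r * \<phi> x) ^ k) \<partial>M) \<le> r ^ k" by (simp add: prob_space)
  qed
  have zgeo: "AE x in M. (\<Sum>k. (of_real r * \<phi> x) ^ k) = 1 / z x"
    using bd[of 1]
  proof eventually_elim
    case (elim x)
    then have "norm (of_real r * \<phi> x) < 1" using r by simp
    then show ?case unfolding z_def by (rule suminf_geometric)
  qed
  \<comment> \<open>The geometric series may be integrated termwise because \<open>r < 1\<close>
    supplies the summable majorant \<open>r ^ k\<close>.\<close>
  have "(CLINT x|M. 1 / z x) = (CLINT x|M. (\<Sum>k. (of_real r * \<phi> x) ^ k))"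
  proof (rule integral_cong_AE)
    show "AE x in M. 1 / z x = (\<Sum>k. (of_real r * \<phi> x) ^ k)" using zgeo by eventually_elim simp
  qed (simp_all add: z_def)
  also have "\<dots> = (\<Sum>k. CLINT x|M. (of_real r * \<phi> x) ^ k)"
    by (rule integral_suminf[OF int sumnorm sumint])
  finally have zsum: "(CLINT x|M. 1 / z x) = (\<Sum>k. of_real (r ^ k * q k))"
    by (simp only: intk)
  have q1: "\<bar>q k\<bar> \<le> 1" for k
  proof -
    have "\<bar>q k\<bar> = norm (CLINT x|M. \<phi> x ^ k)" by (simp add: q[symmetric])
    also have "\<dots> \<le> (\<integral>x. norm (\<phi> x ^ k) \<partial>M)" by (rule integral_norm_bound)
    also have "\<dots> \<le> (\<integral>x. 1 \<partial>M)"
    proof (rule integral_mono_AE)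
      show ae: "AE x in M. norm (\<phi> x ^ k) \<le> 1" using le1 by eventually_elim (simp add: norm_power power_le_one)
      show "integrable M (\<lambda>x. norm (\<phi> x ^ k))" using ae by (intro integrable_const_bound[where B = 1]) auto
    qed auto
    finally show ?thesis by (simp add: prob_space)
  qed
  have "summable (\<lambda>k. r ^ k * q k)"
  proof (rule summable_comparison_test[OF _ geo], intro exI allI impI)
    fix k show "norm (r ^ k * q k) \<le> r ^ k" using r q1[of k] by (simp add: abs_mult mult_left_le)
  qed
  then have "(CLINT x|M. 1 / z x) = of_real (\<Sum>k. r ^ k * q k)"
    unfolding zsum by (simp only: suminf_of_real)
  then have U: "(\<Sum>k. r ^ k * q k) = Re (CLINT x|M. 1 / z x)" by simp
  have bounds: "AE x in M. m / K\<^sup>2 * (1 / (\<epsilon> + h x)) \<le> Re (1 / z x) \<and> Re (1 / z x) \<le> 1 / m * (1 / (\<epsilon> + h x)) \<and> cmod (1 / z x) \<le> 1 / m * (1 / (\<epsilon> + h x))"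
    using sym
  proof eventually_elim
    case (elim x)
    define w where "w = \<epsilon> + h x"
    have w: "w > 0" using h[of x] \<epsilon> by (simp add: w_def add_pos_nonneg)
    have Rez: "Re (z x) = \<epsilon> + r * Re (1 - \<phi> x)" by (simp add: z_def r_def algebra_simps)
    \<comment> \<open>The factor 2 in the hypothesis on \<open>Re (1 - \<phi> x)\<close> pays for
      \<open>r \<ge> 1 / 2\<close>, which in turn comes from \<open>J \<ge> 1\<close>.\<close>
    have "m * w \<le> \<epsilon> + (1 / 2) * (2 * m * h x)"
      using mult_right_mono[OF \<open>m \<le> 1\<close>, of \<epsilon>] \<epsilon> by (simp add: w_def algebra_simps)
    also have "\<dots> \<le> \<epsilon> + r * Re (1 - \<phi> x)"
      using elim r h[of x] \<open>m > 0\<close> by (intro add_left_mono mult_mono) auto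
    finally have Re_ge: "m * w \<le> Re (z x)" using Rez by simp
    then have Re_pos: "0 < Re (z x)" using \<open>m > 0\<close> w mult_pos_pos[of m w] by linarith
    have "z x = of_real \<epsilon> + of_real r * (1 - \<phi> x)" by (simp add: z_def r_def algebra_simps)
    then have "cmod (z x) \<le> cmod (of_real \<epsilon>) + cmod (of_real r * (1 - \<phi> x))"
      by (simp only: norm_triangle_ineq)
    also have "\<dots> = \<epsilon> + r * cmod (1 - \<phi> x)" using \<epsilon> r by (simp add: norm_mult)
    also have "\<dots> \<le> K * \<epsilon> + 1 * (K * h x)"
      using elim r \<epsilon> \<open>K \<ge> 1\<close> by (intro add_mono mult_mono) auto
    also have "\<dots> = K * w" by (simp add: w_def algebra_simps)
    finally have cmod_le: "cmod (z x) \<le> K * w" .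
    have cmod_ge: "m * w \<le> cmod (z x)" using Re_ge complex_Re_le_cmod[of "z x"] by linarith
    have mw: "0 < m * w" using \<open>m > 0\<close> w by simp
    have cz: "0 < cmod (z x)" using cmod_ge mw by linarith
    \<comment> \<open>The lower bound on this quotient needs \<open>Re (z x)\<close> from below and
      \<open>cmod (z x)\<close> from above, hence the factor \<open>m / K^2\<close>; the upper bound
      uses only \<open>m * w \<le> cmod (z x)\<close>.\<close>
    have Re_inv: "Re (1 / z x) = Re (z x) / (cmod (z x))\<^sup>2"
      by (simp add: Re_divide cmod_power2)
    have "m / K\<^sup>2 * (1 / w) = (m * w) / (K * w)\<^sup>2"
      using w by (simp add: power2_eq_square field_simps)
    also have "\<dots> \<le> Re (z x) / (cmod (z x))\<^sup>2"
      using Re_ge cmod_le cz mw Re_pos by (intro frac_le power_mono) auto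
    finally have 1: "m / K\<^sup>2 * (1 / w) \<le> Re (1 / z x)" using Re_inv by simp
    have "cmod (1 / z x) = 1 / cmod (z x)" by (simp add: norm_divide)
    also have "\<dots> \<le> 1 / (m * w)" using cmod_ge mw by (intro divide_left_mono) (auto intro: mult_pos_pos cz)
    finally have 2: "cmod (1 / z x) \<le> 1 / m * (1 / w)" by simp
    have "Re (1 / z x) \<le> cmod (1 / z x)" by (rule complex_Re_le_cmod)
    then have 3: "Re (1 / z x) \<le> 1 / m * (1 / w)" using 2 by (rule order_trans)
    show ?case using 1 2 3 unfolding w_def by blast
  qed
  note dyadic = integral_dyadic[OF assms(2) h lo up, of J, folded \<epsilon>_def]
  have zint: "integrable M (\<lambda>x. 1 / z x)"
  proof (rule Bochner_Integration.integrable_bound)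
    show "integrable M (\<lambda>x. 1 / m * (1 / (\<epsilon> + h x)))" by (intro integrable_mult_right dyadic)
    show "AE x in M. norm (1 / z x) \<le> norm (1 / m * (1 / (\<epsilon> + h x)))"
      using bounds by eventually_elim (metis abs_ge_self order_trans real_norm_def)
  qed (simp add: z_def)
  have U2: "(\<Sum>k. r ^ k * q k) = (\<integral>x. Re (1 / z x) \<partial>M)"
    unfolding U by (rule integral_Re[OF zint, symmetric])
  have Rint: "integrable M (\<lambda>x. Re (1 / z x))" using zint by (rule integrable_Re)
  have "m / K\<^sup>2 * (a / 4 * (real J + 1)) \<le> m / K\<^sup>2 * expectation (\<lambda>x. 1 / (\<epsilon> + h x))"
    using \<open>m > 0\<close> by (intro mult_left_mono dyadic) auto
  also have "\<dots> = expectation (\<lambda>x. m / K\<^sup>2 * (1 / (\<epsilon> + h x)))"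
    by (rule integral_mult_right_zero[symmetric])
  also have "\<dots> \<le> (\<Sum>k. r ^ k * q k)"
    unfolding U2
  proof (rule integral_mono_AE[OF _ Rint])
    show "integrable M (\<lambda>x. m / K\<^sup>2 * (1 / (\<epsilon> + h x)))" by (intro integrable_mult_right dyadic)
    show "AE x in M. m / K\<^sup>2 * (1 / (\<epsilon> + h x)) \<le> Re (1 / z x)" using bounds by eventually_elim blast
  qed
  finally show "m / K\<^sup>2 * (a / 4 * (real J + 1)) \<le> (\<Sum>k. (1 - (1 / 2) ^ J) ^ k * q k)"
    unfolding r_def \<epsilon>_def .
  have "(\<Sum>k. r ^ k * q k) \<le> expectation (\<lambda>x. 1 / m * (1 / (\<epsilon> + h x)))"
    unfolding U2
  proof (rule integral_mono_AE[OF Rint])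
    show "integrable M (\<lambda>x. 1 / m * (1 / (\<epsilon> + h x)))" by (intro integrable_mult_right dyadic)
    show "AE x in M. Re (1 / z x) \<le> 1 / m * (1 / (\<epsilon> + h x))" using bounds by eventually_elim blast
  qed
  also have "\<dots> = 1 / m * expectation (\<lambda>x. 1 / (\<epsilon> + h x))"
    by (rule integral_mult_right_zero)
  also have "\<dots> \<le> 1 / m * (2 * (real J + 1) + 1)"
    using \<open>m > 0\<close> by (intro mult_left_mono dyadic) auto
  finally show "(\<Sum>k. (1 - (1 / 2) ^ J) ^ k * q k) \<le> 1 / m * (2 * (real J + 1) + 1)"
    unfolding r_def \<epsilon>_def .
qed

text \<open>An elementary Tauberian argument at \<open>r = 1 - (1 / 2) ^ J\<close>. Up to time
  \<open>2 ^ J\<close> the weights \<open>r ^ k\<close> are at least 1/4, so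
  \<open>G (2 ^ J)\<close> is at most four Abel sums. Beyond time \<open>4 ^ J\<close> the weights
  sum to at most 1, so \<open>G (4 ^ J)\<close> is at least the Abel sum minus 1. Passing from
  \<open>2 ^ J\<close> to \<open>4 ^ J\<close> merely doubles the logarithm.\<close>

lemma log_bounds_from_abel_sums:
  fixes q :: "nat \<Rightarrow> real"
  assumes q: "\<And>k. 0 \<le> q k" "\<And>k. q k \<le> 1" and "c0 > 0" "C0 > 0"
    and lo: "\<And>J. J \<ge> 1 \<Longrightarrow> c0 * (real J + 1) \<le> (\<Sum>k. (1 - (1 / 2) ^ J) ^ k * q k)"
    and up: "\<And>J. J \<ge> 1 \<Longrightarrow> (\<Sum>k. (1 - (1 / 2) ^ J) ^ k * q k) \<le> C0 * (real J + 1)"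
  shows "\<exists>c>0. \<exists>C. (\<forall>\<^sub>F n in sequentially. c * ln (real n) \<le> (\<Sum>k\<le>n. q k)) \<and>
           (\<forall>\<^sub>F n in sequentially. (\<Sum>k\<le>n. q k) \<le> C * ln (real n))"
proof -
  define G where "G n = (\<Sum>k\<le>n. q k)" for n
  have Gmono: "G i \<le> G j" if "i \<le> j" for i j
    unfolding G_def using that q by (intro sum_mono2) auto
  define r where "r J = 1 - (1 / 2 :: real) ^ J" for J
  have r: "1 / 2 \<le> r J" "r J < 1" if "J \<ge> 1" for J
    using power_decreasing[of 1 J "1 / 2 :: real"] that by (auto simp: r_def)
  have summ: "summable (\<lambda>k. r J ^ k * q k)" if J: "J \<ge> 1" for J
  proof (rule summable_comparison_test)
    show "summable (\<lambda>k. r J ^ k)" using r[OF J] by (intro summable_geometric) auto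
    show "\<exists>N. \<forall>k\<ge>N. norm (r J ^ k * q k) \<le> r J ^ k"
      using q r[OF J] by (auto simp: abs_mult mult_left_le)
  qed
  have upG: "G (2 ^ J) \<le> 4 * C0 * (real J + 1)" if J: "J \<ge> 1" for J
  proof -
    obtain J' where J': "J = Suc J'" using J by (cases J) auto
    \<comment> \<open>Bernoulli's inequality with exponent \<open>2 ^ J\<close> would only give 0.
      At half that exponent it gives 1/2, and squaring gives 1/4.\<close>
    have "1 + real (2 ^ J') * (- ((1 / 2) ^ J)) \<le> (1 + (- ((1 / 2) ^ J))) ^ (2 ^ J')"
      using r[OF J] by (intro Bernoulli_inequality) (auto simp: r_def)
    then have "1 / 2 \<le> r J ^ (2 ^ J')" by (simp add: r_def J' power_one_over)
    then have "(1 / 2)\<^sup>2 \<le> (r J ^ (2 ^ J'))\<^sup>2" by (rule power_mono) simp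
    moreover have "(r J ^ (2 ^ J'))\<^sup>2 = r J ^ (2 ^ J)"
      by (simp add: J' power_mult[symmetric] mult.commute)
    ultimately have quarter: "1 / 4 \<le> r J ^ (2 ^ J)"
      by (simp add: power2_eq_square)
    have "G (2 ^ J) \<le> (\<Sum>k\<le>2 ^ J. 4 * (r J ^ k * q k))"
      unfolding G_def
    proof (rule sum_mono)
      fix k :: nat assume "k \<in> {..2 ^ J}"
      then have "r J ^ (2 ^ J) \<le> r J ^ k" using r[OF J] by (intro power_decreasing) auto
      then have "1 * q k \<le> (4 * r J ^ k) * q k" using quarter q by (intro mult_right_mono) auto
      then show "q k \<le> 4 * (r J ^ k * q k)" by simp
    qed
    also have "\<dots> = 4 * (\<Sum>k\<le>2 ^ J. r J ^ k * q k)" by (simp add: sum_distrib_left)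
    also have "\<dots> \<le> 4 * (\<Sum>k. r J ^ k * q k)"
      using q r[OF J] by (intro mult_left_mono sum_le_suminf summ[OF J]) auto
    also have "\<dots> \<le> 4 * (C0 * (real J + 1))"
      unfolding r_def by (intro mult_left_mono up J) auto
    finally show ?thesis by simp
  qed
  have loG: "c0 * (real J + 1) - 1 \<le> G (4 ^ J)" if J: "J \<ge> 1" for J
  proof -
    define n where "n = Suc (4 ^ J)"
    have "c0 * (real J + 1) \<le> (\<Sum>k. r J ^ k * q k)" unfolding r_def by (rule lo[OF J])
    also have "\<dots> = (\<Sum>k. r J ^ (k + n) * q (k + n)) + (\<Sum>k<n. r J ^ k * q k)"
      by (rule suminf_split_initial_segment[OF summ[OF J]])
    also have "(\<Sum>k<n. r J ^ k * q k) \<le> G (4 ^ J)"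
      unfolding G_def n_def lessThan_Suc_atMost
      using q r[OF J] by (intro sum_mono) (auto intro!: mult_left_le_one_le power_le_one)
    also have "(\<Sum>k. r J ^ (k + n) * q (k + n)) \<le> (\<Sum>k. r J ^ n * r J ^ k)"
    proof (rule suminf_le)
      show "summable (\<lambda>k. r J ^ (k + n) * q (k + n))" by (rule summable_iff_shift[THEN iffD2, OF summ[OF J]])
      show "summable (\<lambda>k. r J ^ n * r J ^ k)" using r[OF J] by (intro summable_mult summable_geometric) auto
      show "r J ^ (k + n) * q (k + n) \<le> r J ^ n * r J ^ k" for k
        using q r[OF J] by (simp add: power_add mult.commute mult_left_le)
    qed
    also have "\<dots> = r J ^ n * (1 / (1 - r J))"
      using r[OF J] by (subst suminf_mult) (auto simp: suminf_geometric)
    also have "\<dots> = r J ^ n * 2 ^ J" by (simp add: r_def power_one_over)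
    also have "\<dots> \<le> 1"
    proof -
      have "r J ^ n \<le> r J ^ (4 ^ J)" unfolding n_def using r[OF J] by (intro power_decreasing) auto
      also have "\<dots> \<le> exp (- ((1 / 2) ^ J)) ^ (4 ^ J)"
        using r[OF J] exp_ge_add_one_self[of "- ((1 / 2) ^ J)"] by (intro power_mono) (auto simp: r_def)
      also have "\<dots> = exp (real (4 ^ J) * (- ((1 / 2) ^ J)))" by (simp only: exp_of_nat_mult)
      also have "real (4 ^ J) * (- ((1 / 2) ^ J)) = - (2 ^ J)"
        by (simp add: power_mult_distrib[symmetric])
      finally have "r J ^ n \<le> exp (- (2 ^ J))" .
      moreover have "2 ^ J \<le> exp (2 ^ J :: real)"
        using exp_ge_add_one_self[of "2 ^ J :: real"] by linarith
      ultimately have "r J ^ n * 2 ^ J \<le> exp (- (2 ^ J)) * exp (2 ^ J)"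
        by (intro mult_mono) auto
      also have "\<dots> = 1" by (simp add: exp_minus)
      finally show ?thesis .
    qed
    finally show ?thesis by simp
  qed
  define J where "J n = nat \<lfloor>log 2 (real n)\<rfloor>" for n
  have Jn: "2 ^ J n \<le> n" "n \<le> 2 ^ Suc (J n)" "real (J n) \<le> log 2 (real n)" "log 2 (real n) < real (J n) + 1" if "n \<ge> 1" for n
  proof -
    have n: "real n \<ge> 1" using that by simp
    show lg: "real (J n) \<le> log 2 (real n)" "log 2 (real n) < real (J n) + 1"
      using n unfolding J_def by auto
    have "real (2 ^ J n) \<le> real n"
      using lg(1) n by (subst (asm) le_log_iff) (auto simp: powr_realpow)
    then show "2 ^ J n \<le> n" by (simp only: of_nat_le_iff)
    have "real n < real (2 ^ Suc (J n))"
      using lg(2) n by (subst (asm) log_less_iff) (auto simp: powr_realpow powr_add)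
    then show "n \<le> 2 ^ Suc (J n)" by (simp only: of_nat_less_iff)
  qed
  have ev2: "\<forall>\<^sub>F n in sequentially. 2 \<le> log 2 (real n)" by real_asymp
  \<comment> \<open>Beyond this threshold the lost summand 1 is at most half of the main term
    \<open>c0 / 2 * log 2 n\<close>.\<close>
  have evc: "\<forall>\<^sub>F n in sequentially. 4 / c0 \<le> log 2 (real n)"
    by (rule filterlim_at_top[THEN iffD1, rule_format]) real_asymp
  have "\<forall>\<^sub>F n in sequentially. G n \<le> (8 * C0 / ln 2) * ln (real n)"
    using ev2 eventually_ge_at_top[of 1]
  proof eventually_elim
    case (elim n)
    have "G n \<le> G (2 ^ Suc (J n))" using Jn(2)[OF elim(2)] by (rule Gmono)
    also have "\<dots> \<le> 4 * C0 * (real (Suc (J n)) + 1)" by (rule upG) simp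
    also have "\<dots> \<le> 4 * C0 * (2 * log 2 (real n))"
      using Jn(3)[OF elim(2)] elim(1) \<open>C0 > 0\<close> by (intro mult_left_mono) auto
    finally show ?case by (simp add: log_def)
  qed
  moreover have "\<forall>\<^sub>F n in sequentially. (c0 / (4 * ln 2)) * ln (real n) \<le> G n"
    using ev2 evc eventually_ge_at_top[of 1]
  proof eventually_elim
    case (elim n)
    \<comment> \<open>Half of the exponent, so that \<open>4 ^ I \<le> n\<close>.\<close>
    define I where "I = J n div 2"
    have "J n \<ge> 2" using Jn(4)[OF elim(3)] elim(1) by linarith
    then have I: "I \<ge> 1" by (simp add: I_def)
    have "J n + 1 \<le> 2 * (I + 1)" by (simp add: I_def)
    then have "real (J n + 1) \<le> real (2 * (I + 1))" by (simp only: of_nat_le_iff)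
    then have "real (J n) + 1 \<le> 2 * (real I + 1)" by simp
    with Jn(4)[OF elim(3)] have I2: "log 2 (real n) \<le> 2 * (real I + 1)" by (meson less_imp_le order_trans)
    have "(4 :: nat) ^ I = 2 ^ (2 * I)" by (simp add: power_mult)
    also have "\<dots> \<le> 2 ^ J n" by (intro power_increasing) (auto simp: I_def)
    also have "\<dots> \<le> n" by (rule Jn(1)[OF elim(3)])
    finally have "G (4 ^ I) \<le> G n" by (rule Gmono)
    then have "c0 * (real I + 1) - 1 \<le> G n" using loG[OF I] by linarith
    moreover have "c0 * (log 2 (real n) / 2) \<le> c0 * (real I + 1)"
      using I2 \<open>c0 > 0\<close> by (intro mult_left_mono) auto
    moreover have "1 \<le> c0 / 4 * log 2 (real n)"
      using elim(2) \<open>c0 > 0\<close> by (simp add: field_simps)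
    ultimately have "c0 / 4 * log 2 (real n) \<le> G n" by (simp add: field_simps)
    then show ?case by (simp add: log_def)
  qed
  moreover have "c0 / (4 * ln 2) > 0" using \<open>c0 > 0\<close> by simp
  ultimately show ?thesis unfolding G_def by blast
qed

section \<open>The symbol of the walk\<close>

definition symbol :: "(int ^ 'n) pmf \<Rightarrow> real ^ 'n \<Rightarrow> complex" where
  "symbol p t = (CLINT x|measure_pmf p. iexp (t \<bullet> rvec x))"

lemma rvec_0 [simp]: "rvec 0 = 0"
  and rvec_add: "rvec (x + y) = rvec x + rvec y"
  and rvec_uminus: "rvec (- x) = - rvec x"
  by (simp_all add: rvec_def vec_eq_iff)

lemma rvec_sum: "rvec (\<Sum>i\<in>A. f i) = (\<Sum>i\<in>A. rvec (f i))"
  by (induction A rule: infinite_finite_induct) (simp_all add: rvec_add)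

lemma rvec_axis: "rvec (axis i c) = axis i (real_of_int c)"
  by (simp add: rvec_def axis_def vec_eq_iff)

lemma integrable_pmf_bounded:
  fixes f :: "'a \<Rightarrow> 'b :: {banach, second_countable_topology}"
  assumes "\<And>x. norm (f x) \<le> B"
  shows "integrable (measure_pmf p) f"
  using assms by (intro measure_pmf.integrable_const_bound[where B = B]) auto

lemma cmod_symbol_le_1: "cmod (symbol p t) \<le> 1"
proof -
  have "cmod (symbol p t) \<le> (\<integral>x. cmod (iexp (t \<bullet> rvec x)) \<partial>measure_pmf p)"
    unfolding symbol_def by (rule integral_norm_bound)
  then show ?thesis by simp
qed

lemma one_minus_symbol: "1 - symbol p t = (CLINT x|measure_pmf p. 1 - iexp (t \<bullet> rvec x))"
  unfolding symbol_def by (subst Bochner_Integration.integral_diff) (auto intro!: integrable_pmf_bounded[where B = 1])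

lemma Re_one_minus_symbol: "Re (1 - symbol p t) = (\<integral>x. 1 - cos (t \<bullet> rvec x) \<partial>measure_pmf p)"
proof -
  have "integrable (measure_pmf p) (\<lambda>x. 1 - iexp (t \<bullet> rvec x))"
    by (intro integrable_pmf_bounded[where B = 2] order_trans[OF norm_triangle_ineq4]) auto
  then show ?thesis unfolding one_minus_symbol by (subst integral_Re[symmetric]) (simp_all add: Re_exp)
qed

lemma integrable_one_minus_cos: "integrable (measure_pmf p) (\<lambda>x. 1 - cos (f x) :: real)"
proof (rule integrable_pmf_bounded[where B = 2])
  show "norm (1 - cos (f x)) \<le> 2" for x
    using cos_ge_minus_one[of "f x"] cos_le_one[of "f x"] by (simp only: real_norm_def abs_le_iff) linarith
qed

lemma continuous_symbol: "continuous_on UNIV (symbol p)" for p :: "(int ^ 'n) pmf"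
proof -
  have "isCont (symbol p) t" for t
    unfolding isCont_def symbol_def
  proof (rule tendsto_at_iff_sequentially[THEN iffD2], intro allI impI)
    fix u :: "nat \<Rightarrow> real ^ 'n"
    assume "\<forall>i. u i \<in> UNIV - {t}" and u: "u \<longlonglongrightarrow> t"
    show "((\<lambda>t. CLINT x|measure_pmf p. iexp (t \<bullet> rvec x)) \<circ> u) \<longlonglongrightarrow> (CLINT x|measure_pmf p. iexp (t \<bullet> rvec x))"
      unfolding o_def
    proof (rule integral_dominated_convergence[where w = "\<lambda>_. 1"])
      show "AE x in measure_pmf p. (\<lambda>n. iexp (u n \<bullet> rvec x)) \<longlonglongrightarrow> iexp (t \<bullet> rvec x)"
        using u by (intro AE_I2 tendsto_intros)
    qed auto
  qed
  then show ?thesis by (simp add: continuous_on_eq_continuous_at)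
qed

lemma symbol_measurable [measurable]: "symbol p \<in> borel_measurable borel"
  by (rule borel_measurable_continuous_onI[OF continuous_symbol])

text \<open>The points \<open>x\<close> for which \<open>1 - cos (t \<bullet> x)\<close> is dominated by \<open>Re (1 - symbol p t)\<close> form a subgroup
  that contains the support.\<close>

lemma one_minus_cos_le:
  assumes gen: "generating p"
  shows "\<exists>C\<ge>0. \<forall>t. 1 - cos (t \<bullet> rvec x) \<le> C * Re (1 - symbol p t)"
proof -
  define L where "L = {x. \<exists>C\<ge>0. \<forall>t. 1 - cos (t \<bullet> rvec x) \<le> C * Re (1 - symbol p t)}"
  \<comment> \<open>As \<open>1 - cos u\<close> is \<open>2 * (sin (u / 2))^2\<close>, this is the
    squared form of the subadditivity of \<open>\<bar>sin\<bar>\<close>; it makes \<open>L\<close>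
    closed under addition.\<close>
  have cos_add_le: "1 - cos (a + b) \<le> 2 * (1 - cos a) + 2 * (1 - cos b)" for a b :: real
  proof -
    define A B where "A = cos ((a + b) / 2)" and "B = cos ((a - b) / 2)"
    have "0 \<le> (B - A)\<^sup>2" by simp
    then have "2 * (A * B) \<le> B\<^sup>2 + A\<^sup>2" by (simp add: power2_diff mult_ac)
    moreover have "cos a + cos b = 2 * (A * B)" by (simp add: cos_plus_cos A_def B_def)
    moreover have "cos (a + b) = 2 * A\<^sup>2 - 1"
      using cos_double_cos[of "(a + b) / 2"] unfolding A_def by (metis field_sum_of_halves mult_2)
    moreover have "B\<^sup>2 \<le> 1" by (simp add: B_def abs_square_le_1)
    ultimately show ?thesis unfolding right_diff_distrib by linarith
  qed
  have "add_subgroup L"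
    unfolding add_subgroup_def
  proof (intro conjI ballI)
    show "0 \<in> L" by (auto simp: L_def)
    show "- x \<in> L" if "x \<in> L" for x using that by (simp add: L_def rvec_uminus)
    show "x + y \<in> L" if xy: "x \<in> L" "y \<in> L" for x y
    proof -
      obtain C D where C: "C \<ge> 0" "\<And>t. 1 - cos (t \<bullet> rvec x) \<le> C * Re (1 - symbol p t)"
        and D: "D \<ge> 0" "\<And>t. 1 - cos (t \<bullet> rvec y) \<le> D * Re (1 - symbol p t)"
        using xy by (auto simp: L_def)
      have "1 - cos (t \<bullet> rvec (x + y)) \<le> (2 * C + 2 * D) * Re (1 - symbol p t)" for t
      proof -
        have "1 - cos (t \<bullet> rvec (x + y)) \<le> 2 * (1 - cos (t \<bullet> rvec x)) + 2 * (1 - cos (t \<bullet> rvec y))"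
          unfolding rvec_add inner_add_right by (rule cos_add_le)
        also have "\<dots> \<le> 2 * (C * Re (1 - symbol p t)) + 2 * (D * Re (1 - symbol p t))"
          by (intro add_mono mult_left_mono C D) auto
        finally show ?thesis by (simp add: algebra_simps)
      qed
      then show ?thesis using C(1) D(1) unfolding L_def by (intro CollectI exI[of _ "2 * C + 2 * D"]) auto
    qed
  qed
  moreover have "set_pmf p \<subseteq> L"
  proof
    fix y assume y: "y \<in> set_pmf p"
    have pos: "pmf p y > 0" using y by (simp add: pmf_positive)
    have "1 - cos (t \<bullet> rvec y) \<le> 1 / pmf p y * Re (1 - symbol p t)" for t
    proof -
      have "pmf p y * (1 - cos (t \<bullet> rvec y)) = (\<integral>x. indicator {y} x * (1 - cos (t \<bullet> rvec y)) \<partial>measure_pmf p)"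
        by (simp add: measure_pmf_single)
      also have "\<dots> \<le> (\<integral>x. 1 - cos (t \<bullet> rvec x) \<partial>measure_pmf p)"
      proof (rule integral_mono[OF _ integrable_one_minus_cos])
        show "integrable (measure_pmf p) (\<lambda>x. indicator {y} x * (1 - cos (t \<bullet> rvec y)))"
          by (intro integrable_pmf_bounded[where B = "\<bar>1 - cos (t \<bullet> rvec y)\<bar>"]) (auto simp: indicator_def)
        show "indicator {y} x * (1 - cos (t \<bullet> rvec y)) \<le> 1 - cos (t \<bullet> rvec x)" for x
          by (auto simp: indicator_def)
      qed
      finally show ?thesis
        unfolding Re_one_minus_symbol using pos by (simp add: pos_le_divide_eq mult.commute)
    qed
    then show "y \<in> L" using pos unfolding L_def by (intro CollectI exI[of _ "1 / pmf p y"]) auto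
  qed
  ultimately have "L = UNIV" using gen unfolding generating_def by blast
  then show ?thesis unfolding L_def by blast
qed

text \<open>Jordan's inequality \<open>sin x \<ge> 2 * x / pi\<close> on \<open>{0..pi/2}\<close>,
  from concavity of the sine, applied at \<open>\<bar>u\<bar> / 2\<close> and squared.\<close>

lemma one_minus_cos_ge:
  assumes "\<bar>u\<bar> \<le> pi"
  shows "2 / pi\<^sup>2 * u\<^sup>2 \<le> 1 - cos u"
proof -
  have conv: "convex_on {0..pi} (\<lambda>x. - sin x)"
    by (rule f''_ge0_imp_convex[where f' = "\<lambda>x. - cos x" and f'' = sin])
       (auto intro!: derivative_eq_intros sin_ge_zero)
  define v where "v = \<bar>u\<bar> / pi"
  have v: "0 \<le> v" "v \<le> 1" using assms by (auto simp: v_def)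
  have "- sin ((1 - v) *\<^sub>R 0 + v *\<^sub>R (pi / 2)) \<le> (1 - v) * (- sin 0) + v * (- sin (pi / 2))"
    using v by (intro convex_onD[OF conv]) auto
  then have "v \<le> sin (\<bar>u\<bar> / 2)" by (simp add: v_def)
  then have "v\<^sup>2 \<le> (sin (\<bar>u\<bar> / 2))\<^sup>2" using v by (intro power_mono) auto
  moreover have "cos u = 1 - 2 * (sin (\<bar>u\<bar> / 2))\<^sup>2"
    using cos_double_sin[of "\<bar>u\<bar> / 2"] by simp
  ultimately show ?thesis by (simp add: v_def power_divide)
qed

text \<open>The unit vectors are among the points dominated in \<open>one_minus_cos_le\<close>, and
  on the torus each \<open>1 - cos (t $ i)\<close> is at least quadratic. In dimension two this is
  the required order; in dimension one it serves away from 0, where the expansion in A1 says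
  nothing.\<close>

lemma Re_one_minus_symbol_ge:
  assumes gen: "generating p"
  shows "\<exists>c>0. \<forall>t. (\<forall>i. \<bar>t $ i\<bar> \<le> pi) \<longrightarrow> c * (norm t)\<^sup>2 \<le> Re (1 - symbol p t)"
proof -
  have "\<exists>C. \<forall>i. C i \<ge> 0 \<and> (\<forall>t. 1 - cos (t $ i) \<le> C i * Re (1 - symbol p t))"
  proof (rule choice, rule allI)
    fix i
    show "\<exists>C. C \<ge> 0 \<and> (\<forall>t. 1 - cos (t $ i) \<le> C * Re (1 - symbol p t))"
      using one_minus_cos_le[OF gen, of "axis i 1"] by (simp add: rvec_axis inner_axis)
  qed
  then obtain C where C: "\<And>i. C i \<ge> 0" "\<And>i t. 1 - cos (t $ i) \<le> C i * Re (1 - symbol p t)" by blast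
  define D where "D = 1 + (\<Sum>i\<in>UNIV. C i)"
  have D: "D > 0" using C(1) unfolding D_def by (intro add_pos_nonneg sum_nonneg) auto
  have "2 / (pi\<^sup>2 * D) * (norm t)\<^sup>2 \<le> Re (1 - symbol p t)" if t: "\<forall>i. \<bar>t $ i\<bar> \<le> pi" for t
  proof -
    have nn: "0 \<le> Re (1 - symbol p t)"
      unfolding Re_one_minus_symbol by (intro integral_nonneg_AE) auto
    have "2 / pi\<^sup>2 * (norm t)\<^sup>2 = (\<Sum>i\<in>UNIV. 2 / pi\<^sup>2 * (t $ i)\<^sup>2)"
    proof -
      have "(norm t)\<^sup>2 = (\<Sum>i\<in>UNIV. (t $ i)\<^sup>2)"
        unfolding power2_norm_eq_inner by (simp add: inner_vec_def power2_eq_square)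
      then show ?thesis by (simp only: sum_distrib_left)
    qed
    also have "\<dots> \<le> (\<Sum>i\<in>UNIV. C i * Re (1 - symbol p t))"
      using t C(2) by (intro sum_mono order_trans[OF one_minus_cos_ge]) auto
    also have "\<dots> = (D - 1) * Re (1 - symbol p t)" by (simp add: D_def sum_distrib_right)
    also have "\<dots> \<le> D * Re (1 - symbol p t)" using nn by (intro mult_right_mono) auto
    finally have "2 / pi\<^sup>2 * (norm t)\<^sup>2 / D \<le> Re (1 - symbol p t)"
      by (simp only: pos_divide_le_eq[OF D] mult.commute)
    then show ?thesis by simp
  qed
  moreover have "2 / (pi\<^sup>2 * D) > 0" using D by simp
  ultimately show ?thesis by blast
qed

text \<open>Since the mean vanishes, the linear term can be added under the integral, and
  \<open>1 - iexp y + \<i> * y\<close> is quadratically small.\<close>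

lemma norm_one_minus_symbol_le:
  fixes p :: "(int ^ 'n) pmf"
  assumes int: "integrable (measure_pmf p) (\<lambda>x. (norm (rvec x))\<^sup>2)"
    and mean: "(\<integral>x. rvec x \<partial>measure_pmf p) = 0"
  shows "cmod (1 - symbol p t) \<le> (\<integral>x. (norm (rvec x))\<^sup>2 \<partial>measure_pmf p) * (norm t)\<^sup>2"
proof -
  have int1: "integrable (measure_pmf p) (\<lambda>x. rvec x)"
  proof (rule Bochner_Integration.integrable_bound)
    show "integrable (measure_pmf p) (\<lambda>x. 1 + (norm (rvec x))\<^sup>2)" using int by simp
    show "AE x in measure_pmf p. norm (rvec x) \<le> norm (1 + (norm (rvec x))\<^sup>2)"
    proof (rule AE_I2)
      fix x
      have "0 \<le> (norm (rvec x) - 1)\<^sup>2" by simp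
      then have "2 * norm (rvec x) \<le> 1 + (norm (rvec x))\<^sup>2" by (simp add: power2_diff)
      then show "norm (rvec x) \<le> norm (1 + (norm (rvec x))\<^sup>2)" using norm_ge_zero[of "rvec x"] unfolding real_norm_def by linarith
    qed
  qed simp
  have intt: "integrable (measure_pmf p) (\<lambda>x. t \<bullet> rvec x)" using int1 by simp
  have "(\<integral>x. t \<bullet> rvec x \<partial>measure_pmf p) = 0" using int1 mean by simp
  then have "(CLINT x|measure_pmf p. \<i> * of_real (t \<bullet> rvec x)) = 0"
    by simp
  then have "1 - symbol p t = (CLINT x|measure_pmf p. 1 - iexp (t \<bullet> rvec x)) + (CLINT x|measure_pmf p. \<i> * of_real (t \<bullet> rvec x))"
    by (simp add: one_minus_symbol)
  also have "\<dots> = (CLINT x|measure_pmf p. (1 - iexp (t \<bullet> rvec x)) + \<i> * of_real (t \<bullet> rvec x))"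
  proof (rule Bochner_Integration.integral_add[symmetric])
    show "complex_integrable (measure_pmf p) (\<lambda>x. 1 - iexp (t \<bullet> rvec x))"
      by (intro integrable_pmf_bounded[where B = 2] order_trans[OF norm_triangle_ineq4]) auto
    show "complex_integrable (measure_pmf p) (\<lambda>x. \<i> * of_real (t \<bullet> rvec x))"
      using intt by simp
  qed
  finally have eq: "1 - symbol p t = (CLINT x|measure_pmf p. (1 - iexp (t \<bullet> rvec x)) + \<i> * of_real (t \<bullet> rvec x))" .
  have bd: "cmod ((1 - iexp y) + \<i> * of_real y) \<le> y\<^sup>2" for y :: real
  proof -
    have "cmod (iexp y - (\<Sum>k\<le>1. (\<i> * y) ^ k / fact k)) \<le> \<bar>y\<bar> ^ Suc 1 / fact (Suc 1)" by (rule iexp_approx1)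
    also have "(\<Sum>k\<le>1. (\<i> * y) ^ k / fact k) = 1 + \<i> * y" by simp
    also have "\<bar>y\<bar> ^ Suc 1 / fact (Suc 1) = y\<^sup>2 / 2" by (simp add: power2_eq_square abs_mult[symmetric])
    also have "\<dots> \<le> y\<^sup>2" by simp
    also have "cmod (iexp y - (1 + \<i> * y)) = cmod ((1 - iexp y) + \<i> * of_real y)"
      by (subst norm_minus_commute) (simp add: algebra_simps)
    finally show ?thesis .
  qed
  have ptw: "cmod ((1 - iexp (t \<bullet> rvec x)) + \<i> * of_real (t \<bullet> rvec x)) \<le> (norm (rvec x))\<^sup>2 * (norm t)\<^sup>2" for x
  proof -
    have "(t \<bullet> rvec x)\<^sup>2 \<le> (norm t * norm (rvec x))\<^sup>2"
      using Cauchy_Schwarz_ineq2[of t "rvec x"] by (metis abs_ge_zero power2_abs power_mono)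
    then show ?thesis using bd[of "t \<bullet> rvec x"] by (simp add: power_mult_distrib mult.commute)
  qed
  have "cmod (1 - symbol p t) \<le> (\<integral>x. (norm (rvec x))\<^sup>2 * (norm t)\<^sup>2 \<partial>measure_pmf p)"
    unfolding eq
  proof (rule order_trans[OF integral_norm_bound integral_mono])
    show int2: "integrable (measure_pmf p) (\<lambda>x. (norm (rvec x))\<^sup>2 * (norm t)\<^sup>2)" using int by simp
    show "integrable (measure_pmf p) (\<lambda>x. cmod ((1 - iexp (t \<bullet> rvec x)) + \<i> * of_real (t \<bullet> rvec x)))"
      by (rule Bochner_Integration.integrable_bound[OF int2]) (use ptw in auto)
  qed (rule ptw)
  then show ?thesis by simp
qed

lemma rvec_measurable: "f \<in> measurable M (count_space UNIV) \<Longrightarrow> (\<lambda>\<omega>. rvec (f \<omega>)) \<in> borel_measurable M"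
  by (rule measurable_compose[where N = "count_space UNIV"]) auto

text \<open>Fourier inversion: the indicator of \<open>W \<omega> = 0\<close> is the torus average
  of the characters at \<open>W \<omega>\<close>. Fubini exchanges the averages, and independence
  turns the expectation into a power.\<close>

lemma ret_prob_eq_integral_symbol:
  fixes X :: "nat \<Rightarrow> 'a \<Rightarrow> int ^ 'n"
  assumes "random_walk M X p"
  shows "complex_of_real (ret_prob p k) = (CLINT f|torus. symbol p (angles f) ^ k)"
proof -
  interpret random_walk M X p by fact
  define W where "W \<omega> = (\<Sum>i\<in>{1..k}. X i \<omega>)" for \<omega>
  have W_block: "W \<omega> = sum_list (block X 0 k \<omega>)" for \<omega>
    using walk_add[of k k X 0 \<omega>] by (simp add: walk_def W_def)
  have W_meas: "W \<in> measurable M (count_space UNIV)"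
    unfolding W_block[abs_def] by (rule measurable_compose[OF block_measurable]) simp
  note [measurable] = rvec_measurable[OF W_meas]
  have EW: "(CLINT \<omega>|M. iexp (t \<bullet> rvec (W \<omega>))) = symbol p t ^ k" for t
  proof -
    define Y where "Y i \<omega> = t \<bullet> rvec (X i \<omega>)" for i \<omega>
    have Y_meas: "Y i \<in> borel_measurable M" if "i \<ge> 1" for i
      unfolding Y_def using rvec_measurable[OF X_measurable[OF that]] by measurable
    \<comment> \<open>Projection to the real variables \<open>Y i\<close>, with characteristic
      functions evaluated at 1, reduces the vector case to the product rule for scalar
      characteristic functions.\<close>
    have char_Y: "char (distr M borel (Y i)) 1 = symbol p t" if i: "i \<in> {1..k}" for i
    proof -
      have "char (distr M borel (Y i)) 1 = (CLINT \<omega>|M. iexp (t \<bullet> rvec (X i \<omega>)))"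
        using i unfolding char_def by (subst integral_distr) (auto simp: Y_def intro!: Y_meas)
      also have "\<dots> = (CLINT x|distr M (count_space UNIV) (X i). iexp (t \<bullet> rvec x))"
        using i by (subst integral_distr) (auto intro!: X_measurable)
      finally show ?thesis using i law by (simp add: symbol_def)
    qed
    have "indep_vars (\<lambda>_. borel) (\<lambda>i \<omega>. t \<bullet> rvec (X i \<omega>)) {1..k}"
      by (rule indep_vars_compose2[OF indep_vars_subset[OF indep]]) auto
    then have "indep_vars (\<lambda>_. borel) Y {1..k}" unfolding Y_def[abs_def] .
    from char_distr_sum[OF this, of 1]
    have "symbol p t ^ k = char (distr M borel (\<lambda>\<omega>. \<Sum>i\<in>{1..k}. Y i \<omega>)) 1"
      by (simp add: char_Y)
    also have "char (distr M borel (\<lambda>\<omega>. \<Sum>i\<in>{1..k}. Y i \<omega>)) 1 = (CLINT \<omega>|M. iexp (\<Sum>i\<in>{1..k}. Y i \<omega>))"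
      unfolding char_def by (subst integral_distr) (auto intro!: borel_measurable_sum Y_meas)
    also have "(\<lambda>\<omega>. \<Sum>i\<in>{1..k}. Y i \<omega>) = (\<lambda>\<omega>. t \<bullet> rvec (W \<omega>))"
      by (simp add: Y_def W_def rvec_sum inner_sum_right)
    finally show ?thesis ..
  qed
  interpret T: prob_space "torus :: ('n \<Rightarrow> real) measure" by (rule prob_space_torus)
  interpret MT: pair_prob_space M "torus :: ('n \<Rightarrow> real) measure" ..
  have "complex_of_real (ret_prob p k) = of_real (prob {\<omega> \<in> space M. W \<omega> = 0})"
    unfolding ret_prob_def W_block using prob_block[of "\<lambda>xs. sum_list xs = 0" 0 k] by simp
  also have "\<dots> = (CLINT \<omega>|M. of_bool (W \<omega> = 0))"
  proof -
    have "{\<omega> \<in> space M. W \<omega> = 0} \<in> sets M"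
      using measurable_sets[OF W_meas, of "{0}"] by (simp add: vimage_def Int_def conj_commute)
    then have "(\<integral>\<omega>. indicator {\<omega> \<in> space M. W \<omega> = 0} \<omega> \<partial>M) = prob {\<omega> \<in> space M. W \<omega> = 0}"
      by (simp add: Int_absorb1)
    then have "of_real (prob {\<omega> \<in> space M. W \<omega> = 0}) = (CLINT \<omega>|M. of_real (indicator {\<omega> \<in> space M. W \<omega> = 0} \<omega>))"
      by (simp only: integral_complex_of_real)
    also have "\<dots> = (CLINT \<omega>|M. of_bool (W \<omega> = 0))"
      by (intro Bochner_Integration.integral_cong) (auto simp: indicator_def)
    finally show ?thesis .
  qed
  also have "\<dots> = (CLINT \<omega>|M. (CLINT f|torus. iexp (angles f \<bullet> rvec (W \<omega>))))"
    by (simp only: integral_torus_iexp)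
  also have "\<dots> = (CLINT f|torus. (CLINT \<omega>|M. iexp (angles f \<bullet> rvec (W \<omega>))))"
  proof (rule MT.Fubini_integral[symmetric], rule MT.integrable_const_bound[where B = 1])
    show "(\<lambda>(\<omega>, f). iexp (angles f \<bullet> rvec (W \<omega>))) \<in> borel_measurable (M \<Otimes>\<^sub>M torus)"
      by measurable
  qed auto
  also have "\<dots> = (CLINT f|torus. symbol p (angles f) ^ k)"
    by (simp only: EW)
  finally show ?thesis .
qed

text \<open>The exponent \<open>CARD('n')\<close> is the one for which
  \<open>norm t ^ CARD('n')\<close> is spread like a uniform variable on the torus; this lets
  dimension one with a linear symbol and dimension two with a quadratic one share a proof.\<close>

lemma green_log_bounds:
  fixes X :: "nat \<Rightarrow> 'a \<Rightarrow> int ^ 'n"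
  assumes rw: "random_walk M X p" and "c1 > 0"
    and lo: "\<And>t. \<forall>i. \<bar>t $ i\<bar> \<le> pi \<Longrightarrow> c1 * norm t ^ CARD('n) \<le> Re (1 - symbol p t)"
    and up: "\<And>t. cmod (1 - symbol p t) \<le> c2 * norm t ^ CARD('n)"
  shows "\<exists>c>0. \<exists>C. (\<forall>\<^sub>F n in sequentially. c * ln (real n) \<le> green p n) \<and>
           (\<forall>\<^sub>F n in sequentially. green p n \<le> C * ln (real n))"
proof -
  interpret T: prob_space "torus :: ('n \<Rightarrow> real) measure" by (rule prob_space_torus)
  define h where "h f = norm (angles f) ^ CARD('n)" for f :: "'n \<Rightarrow> real"
  define m where "m = min 1 (c1 / 2)"
  define K where "K = max 1 c2"
  define a where "a = (1 / (real CARD('n) * pi)) ^ CARD('n)"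
  have a: "a > 0" by (simp add: a_def)
  have m: "m > 0" "m \<le> 1" "2 * m \<le> c1" using \<open>c1 > 0\<close> by (auto simp: m_def min_def)
  have K: "K \<ge> 1" "c2 \<le> K" by (auto simp: K_def)
  have sp: "space torus = (UNIV :: ('n \<Rightarrow> real) set)"
    by (simp add: torus_def space_PiM circle_def)
  have h_meas: "h \<in> borel_measurable torus" unfolding h_def by measurable
  have h_nn: "h f \<ge> 0" for f by (simp add: h_def)
  have sym: "AE f in torus. 2 * m * h f \<le> Re (1 - symbol p (angles f)) \<and>
      cmod (1 - symbol p (angles f)) \<le> K * h f \<and> cmod (symbol p (angles f)) \<le> 1"
    using AE_torus_box
  proof eventually_elim
    case (elim f)
    have "2 * m * h f \<le> c1 * h f" using m h_nn by (intro mult_right_mono) auto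
    also have "\<dots> \<le> Re (1 - symbol p (angles f))" unfolding h_def using elim by (intro lo) simp
    finally have 1: "2 * m * h f \<le> Re (1 - symbol p (angles f))" .
    have "cmod (1 - symbol p (angles f)) \<le> c2 * h f" unfolding h_def by (rule up)
    also have "\<dots> \<le> K * h f" using K h_nn by (intro mult_right_mono) auto
    finally show ?case using 1 cmod_symbol_le_1 by blast
  qed
  have lo': "a * (1 / 2) ^ j \<le> T.prob {f \<in> space torus. h f \<le> (1 / 2) ^ j}"
    and up': "T.prob {f \<in> space torus. h f \<le> (1 / 2) ^ j} \<le> (1 / 2) ^ j" for j :: nat
    using measure_torus_norm_power[of "(1 / 2) ^ j", where 'n = 'n] unfolding sp h_def a_def
    by (simp_all add: power_le_one)
  have symbol_angles: "(\<lambda>f. symbol p (angles f)) \<in> borel_measurable torus" by measurable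
  note abel = T.abel_sum_bounds[OF symbol_angles h_meas ret_prob_eq_integral_symbol[OF rw] h_nn m(1,2) K(1) sym lo' up']
  have "\<exists>c>0. \<exists>C. (\<forall>\<^sub>F n in sequentially. c * ln (real n) \<le> (\<Sum>k\<le>n. ret_prob p k)) \<and>
           (\<forall>\<^sub>F n in sequentially. (\<Sum>k\<le>n. ret_prob p k) \<le> C * ln (real n))"
  proof (rule log_bounds_from_abel_sums)
    show "m / K\<^sup>2 * (a / 4) > 0" using m K a by (intro mult_pos_pos divide_pos_pos) auto
    show "3 / m > 0" using m by simp
    show "m / K\<^sup>2 * (a / 4) * (real J + 1) \<le> (\<Sum>k. (1 - (1 / 2) ^ J) ^ k * ret_prob p k)" if "J \<ge> 1" for J
      using abel(1)[OF that] by (simp add: mult.assoc)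
    show "(\<Sum>k. (1 - (1 / 2) ^ J) ^ k * ret_prob p k) \<le> 3 / m * (real J + 1)" if "J \<ge> 1" for J
    proof -
      have "1 / m * (2 * (real J + 1) + 1) \<le> 1 / m * (3 * (real J + 1))"
        using m by (intro mult_left_mono) auto
      then show ?thesis using abel(2)[OF that] by simp
    qed
  qed (rule ret_prob_nonneg ret_prob_le_1)+
  then show ?thesis unfolding green_def .
qed

section \<open>The three kinds of step distributions\<close>

text \<open>The target is countable, so the points of mass zero together form a null set.\<close>

lemma (in prob_space) ex_pmf_distr:
  fixes \<xi> :: "'a \<Rightarrow> 'b :: countable"
  assumes \<xi>: "\<xi> \<in> measurable M (count_space UNIV)"
  shows "\<exists>p. measure_pmf p = distr M (count_space UNIV) \<xi>"
proof -
  let ?D = "distr M (count_space UNIV) \<xi>"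
  interpret D: prob_space ?D by (rule prob_space_distr[OF \<xi>])
  let ?B = "{x. measure ?D {x} = 0}"
  have "(\<Union>x\<in>?B. {x}) \<in> null_sets ?D"
    by (rule null_sets_UN') (auto simp: null_sets_def D.emeasure_eq_measure)
  then have "AE x in ?D. measure ?D {x} \<noteq> 0" by (intro AE_I'[of ?B]) auto
  then have "measure_pmf (Abs_pmf ?D) = ?D"
    by (intro Abs_pmf_inverse CollectI conjI D.prob_space_axioms) auto
  then show ?thesis by blast
qed

lemma generating_if_prob_1:
  fixes p :: "(int ^ 'n) pmf"
  assumes "\<And>L. add_subgroup L \<Longrightarrow> measure_pmf.prob p L = 1 \<Longrightarrow> L = UNIV"
  shows "generating p"
  unfolding generating_def
proof (intro allI impI)
  fix L :: "(int ^ 'n) set" assume "add_subgroup L" "set_pmf p \<subseteq> L"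
  moreover have "measure_pmf.prob p L = 1"
    using \<open>set_pmf p \<subseteq> L\<close> by (subst measure_pmf.prob_eq_1) (auto intro!: AE_pmfI)
  ultimately show "L = UNIV" using assms by blast
qed

lemma add_subgroup_sum:
  assumes "add_subgroup L" "\<And>i. i \<in> A \<Longrightarrow> f i \<in> L"
  shows "(\<Sum>i\<in>A. f i) \<in> L"
  using assms(2) by (induction A rule: infinite_finite_induct) (use assms(1) in \<open>auto simp: add_subgroup_def\<close>)

lemma add_subgroup_axes:
  fixes L :: "(int ^ 'n) set"
  assumes L: "add_subgroup L" and ax: "\<And>i. axis i 1 \<in> L"
  shows "L = UNIV"
proof -
  have axc: "axis i c \<in> L" for i and c :: int
  proof (induction c rule: int_induct[where k = 0])
    case base
    have "axis i 0 = (0 :: int ^ 'n)" by (simp add: vec_eq_iff axis_def)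
    then show ?case using L by (metis add_subgroup_def)
  next
    case (step1 c)
    have "axis i (c + 1) = axis i c + (axis i 1 :: int ^ 'n)" by (simp add: vec_eq_iff axis_def)
    then show ?case using step1 L ax by (simp add: add_subgroup_def)
  next
    case (step2 c)
    have "axis i (c - 1) = axis i c + - (axis i 1 :: int ^ 'n)" by (simp add: vec_eq_iff axis_def)
    then show ?case using step2 L ax[of i] by (simp only: add_subgroup_def)
  qed
  have "x \<in> L" for x :: "int ^ 'n"
  proof -
    have "x = (\<Sum>i\<in>UNIV. axis i (x $ i))" by (simp add: vec_eq_iff axis_def)
    then show ?thesis using add_subgroup_sum[OF L, of UNIV "\<lambda>i. axis i (x $ i)"] axc by simp
  qed
  then show ?thesis by blast
qed

text \<open>Four unit vectors of probability 1/4 exhaust the mass, so there are no other steps: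
  moments are finite sums, and the mean vanishes by the symmetry
  \<open>e \<mapsto> - e\<close>.\<close>

lemma unit_steps:
  fixes p :: "(int ^ 'n) pmf"
  assumes card: "CARD('n) = 2" and quarter: "\<And>e. norm (rvec e) = 1 \<Longrightarrow> pmf p e = 1 / 4"
  shows "generating p" and "integrable (measure_pmf p) (\<lambda>x. (norm (rvec x))\<^sup>2)"
    and "(\<integral>x. rvec x \<partial>measure_pmf p) = 0"
proof -
  define E where "E = (\<lambda>(i, s). axis i s :: int ^ 'n) ` (UNIV \<times> {1, - 1})"
  have fin: "finite E" by (simp add: E_def)
  have E1: "norm (rvec e) = 1" if "e \<in> E" for e
    using that by (auto simp: E_def rvec_axis norm_eq_sqrt_inner inner_axis_axis)
  have "card E = card ((UNIV :: 'n set) \<times> {1, - 1 :: int})"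
    unfolding E_def by (rule card_image) (auto simp: inj_on_def axis_eq_axis)
  then have "card E = 4" by (simp add: card card_cartesian_product)
  have "measure_pmf.prob p E = (\<Sum>e\<in>E. 1 / 4)"
    unfolding measure_measure_pmf_finite[OF fin] using quarter E1 by (intro sum.cong) auto
  with \<open>card E = 4\<close> have "measure_pmf.prob p E = 1" by simp
  then have "AE x in measure_pmf p. x \<in> E" by (subst (asm) measure_pmf.prob_eq_1) auto
  then have supp: "set_pmf p \<subseteq> E" by (auto simp: AE_measure_pmf_iff)
  show "generating p"
    unfolding generating_def
  proof (intro allI impI)
    fix L :: "(int ^ 'n) set" assume L: "add_subgroup L" "set_pmf p \<subseteq> L"
    have "axis i 1 \<in> L" for i
    proof -
      have "pmf p (axis i 1) \<noteq> 0" using quarter[of "axis i 1"] by (simp add: rvec_axis)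
      then show ?thesis using L(2) by (auto simp: set_pmf_iff)
    qed
    then show "L = UNIV" by (rule add_subgroup_axes[OF L(1)])
  qed
  show "integrable (measure_pmf p) (\<lambda>x. (norm (rvec x))\<^sup>2)"
    using supp E1 by (intro measure_pmf.integrable_const_bound[where B = 1] AE_pmfI) auto
  have "(\<integral>x. rvec x \<partial>measure_pmf p) = (\<Sum>e\<in>E. pmf p e *\<^sub>R rvec e)"
    using supp by (intro integral_measure_pmf fin) auto
  also have "\<dots> = (\<Sum>e\<in>E. (1 / 4) *\<^sub>R rvec e)" using quarter E1 by (intro sum.cong) auto
  also have "\<dots> = 0"
  proof -
    have neg: "- e \<in> E" if "e \<in> E" for e
    proof -
      have "- axis i s = (axis i (- s) :: int ^ 'n)" for i s by (simp add: vec_eq_iff axis_def)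
      then show ?thesis using that by (force simp: E_def)
    qed
    have "(\<Sum>e\<in>E. (1 / 4) *\<^sub>R rvec e) = (\<Sum>e\<in>E. (1 / 4) *\<^sub>R rvec (- e))"
      by (rule sum.reindex_bij_witness[where i = uminus and j = uminus]) (auto intro: neg)
    also have "\<dots> = - (\<Sum>e\<in>E. (1 / 4) *\<^sub>R rvec e)" by (simp add: rvec_uminus sum_negf)
    finally have eq: "(\<Sum>e\<in>E. (1 / 4) *\<^sub>R rvec e) = - (\<Sum>e\<in>E. (1 / 4) *\<^sub>R rvec e)" .
    have "s = 0" if "s = - s" for s :: "real ^ 'n" using that by (simp add: vec_eq_iff)
    then show ?thesis using eq .
  qed
  finally show "(\<integral>x. rvec x \<partial>measure_pmf p) = 0" .
qed

text \<open>Within \<open>\<delta>\<close> of 0 the error in the expansion is at most half of the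
  linear term. Outside, one factor of the quadratic lower bound is at least \<open>\<delta>\<close>,
  and the trivial bound 2 on \<open>cmod (1 - symbol p t)\<close> is at most
  \<open>2 / \<delta> * norm t\<close>.\<close>

lemma symbol_bounds_linear:
  fixes p :: "(int ^ 'n) pmf"
  assumes gen: "generating p" and "\<gamma> > 0"
    and small: "(\<lambda>t. symbol p t - complex_of_real (1 - \<gamma> * norm t)) \<in> o[at 0](\<lambda>t. complex_of_real (norm t))"
  shows "\<exists>c1>0. \<exists>c2. (\<forall>t. (\<forall>i. \<bar>t $ i\<bar> \<le> pi) \<longrightarrow> c1 * norm t \<le> Re (1 - symbol p t)) \<and>
           (\<forall>t. cmod (1 - symbol p t) \<le> c2 * norm t)"
proof -
  have "\<forall>\<^sub>F t in at 0. norm (symbol p t - complex_of_real (1 - \<gamma> * norm t)) \<le> \<gamma> / 2 * norm (complex_of_real (norm t))"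
    using \<open>\<gamma> > 0\<close> by (intro landau_o.smallD[OF small]) simp
  then obtain \<delta> where \<delta>: "\<delta> > 0"
    and near: "\<And>t. t \<noteq> 0 \<Longrightarrow> norm t < \<delta> \<Longrightarrow> cmod (symbol p t - complex_of_real (1 - \<gamma> * norm t)) \<le> \<gamma> / 2 * norm t"
    unfolding eventually_at by (auto simp: dist_norm)
  obtain c where c: "c > 0" "\<And>t. \<forall>i. \<bar>t $ i\<bar> \<le> pi \<Longrightarrow> c * (norm t)\<^sup>2 \<le> Re (1 - symbol p t)"
    using Re_one_minus_symbol_ge[OF gen] by blast
  define c1 where "c1 = min (\<gamma> / 2) (c * \<delta>)"
  define c2 where "c2 = max (2 * \<gamma>) (2 / \<delta>)"
  have symbol_0: "symbol p 0 = 1" by (simp add: symbol_def)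
  have near_bounds: "\<gamma> / 2 * norm t \<le> Re (1 - symbol p t) \<and> cmod (1 - symbol p t) \<le> 2 * \<gamma> * norm t"
    if t: "t \<noteq> 0" "norm t < \<delta>" for t
  proof -
    define d where "d = symbol p t - complex_of_real (1 - \<gamma> * norm t)"
    have d: "cmod d \<le> \<gamma> / 2 * norm t" unfolding d_def using near[OF t] .
    have eq: "1 - symbol p t = complex_of_real (\<gamma> * norm t) - d" by (simp add: d_def)
    have "Re (1 - symbol p t) = \<gamma> * norm t - Re d" unfolding eq by simp
    moreover have "Re d \<le> \<gamma> / 2 * norm t" using complex_Re_le_cmod[of d] d by linarith
    moreover have "cmod (1 - symbol p t) \<le> cmod (complex_of_real (\<gamma> * norm t)) + cmod d"
      unfolding eq by (rule norm_triangle_ineq4)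
    moreover have "cmod (complex_of_real (\<gamma> * norm t)) = \<gamma> * norm t" using \<open>\<gamma> > 0\<close> by (simp add: norm_mult)
    moreover have "\<gamma> * norm t \<ge> 0" using \<open>\<gamma> > 0\<close> by simp
    ultimately show ?thesis using d by (simp add: field_simps)
  qed
  have "c1 * norm t \<le> Re (1 - symbol p t)" if t: "\<forall>i. \<bar>t $ i\<bar> \<le> pi" for t
  proof (cases "t = 0 \<or> norm t < \<delta>")
    case True
    have "c1 * norm t \<le> \<gamma> / 2 * norm t" by (intro mult_right_mono) (auto simp: c1_def)
    then show ?thesis
      using near_bounds[of t] True symbol_0 by (cases "t = 0") (simp, blast intro: order_trans)
  next
    case False
    have "c1 * norm t \<le> c * \<delta> * norm t" by (intro mult_right_mono) (auto simp: c1_def)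
    also have "\<dots> \<le> c * norm t * norm t" using False c(1) by (intro mult_right_mono mult_left_mono) auto
    also have "\<dots> = c * (norm t)\<^sup>2" by (simp add: power2_eq_square)
    also have "\<dots> \<le> Re (1 - symbol p t)" by (rule c(2)[OF t])
    finally show ?thesis .
  qed
  moreover have "cmod (1 - symbol p t) \<le> c2 * norm t" for t
  proof (cases "t = 0 \<or> norm t < \<delta>")
    case True
    have "2 * \<gamma> * norm t \<le> c2 * norm t" by (intro mult_right_mono) (auto simp: c2_def)
    then show ?thesis
      using near_bounds[of t] True symbol_0 by (cases "t = 0") (simp, blast intro: order_trans)
  next
    case False
    have "cmod (1 - symbol p t) \<le> 1 + cmod (symbol p t)" using norm_triangle_ineq4[of 1 "symbol p t"] by simp
    also have "\<dots> \<le> 2" using cmod_symbol_le_1[of p t] by simp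
    also have "\<dots> = 2 / \<delta> * \<delta>" using \<delta> by simp
    also have "\<dots> \<le> c2 * norm t"
    proof (rule mult_mono)
      show "0 \<le> c2" using \<delta> unfolding c2_def by (intro max.coboundedI2) simp
    qed (use False \<delta> in \<open>auto simp: c2_def\<close>)
    finally show ?thesis .
  qed
  moreover have "c1 > 0" using \<open>\<gamma> > 0\<close> c(1) \<delta> by (simp add: c1_def)
  ultimately show ?thesis by blast
qed

theorem theorem6:
  fixes M :: "'a measure"
    and \<xi> :: "'a \<Rightarrow> int ^ 'n"
    and X :: "nat \<Rightarrow> 'a \<Rightarrow> int ^ 'n"
  assumes "prob_space M"
    and "\<xi> \<in> measurable M (count_space UNIV)"
    and "prob_space.indep_vars M (\<lambda>_. count_space UNIV) X {1..}"
    and "\<And>i. i \<ge> 1 \<Longrightarrow> distr M (count_space UNIV) (X i) = distr M (count_space UNIV) \<xi>"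
    and "assumption_A1 M \<xi> \<or> assumption_A2 M \<xi> \<or> assumption_A2' M \<xi>"
  shows "AE \<omega> in M. folner_seq (\<lambda>n. walk_range X n \<omega>)"
proof -
  interpret prob_space M by fact
  obtain p where p: "measure_pmf p = distr M (count_space UNIV) \<xi>"
    using ex_pmf_distr[OF assms(2)] by blast
  have rw: "random_walk M X p"
    using assms(3,4) by unfold_locales (simp_all add: p)
  have symbol: "char_fun M \<xi> t = symbol p t" for t
    unfolding char_fun_def symbol_def p using assms(2) by (subst integral_distr) auto
  have prob_law: "measure M {\<omega> \<in> space M. \<xi> \<omega> \<in> A} = measure_pmf.prob p A" for A
    unfolding p using assms(2) by (subst measure_distr) (auto intro!: arg_cong[where f = "measure M"])
  have aperiodic: "generating p" if "strongly_aperiodic M \<xi>"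
  proof (rule generating_if_prob_1)
    fix L :: "(int ^ 'n) set" assume "add_subgroup L" "measure_pmf.prob p L = 1"
    \<comment> \<open>Strong aperiodicity excludes every coset of a proper subgroup; here it is
      applied to the subgroup itself, with shift 0.\<close>
    moreover from this have "measure M {\<omega> \<in> space M. \<xi> \<omega> - 0 \<in> L} = 1" using prob_law[of L] by simp
    ultimately show "L = UNIV" using that unfolding strongly_aperiodic_def by blast
  qed
  have quadratic: "\<exists>c1>0. \<exists>c2. (\<forall>t. (\<forall>i. \<bar>t $ i\<bar> \<le> pi) \<longrightarrow> c1 * norm t ^ 2 \<le> Re (1 - symbol p t)) \<and>
         (\<forall>t. cmod (1 - symbol p t) \<le> c2 * norm t ^ 2)"
    if "generating p" "integrable (measure_pmf p) (\<lambda>x. (norm (rvec x))\<^sup>2)" "(\<integral>x. rvec x \<partial>measure_pmf p) = 0"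
    using Re_one_minus_symbol_ge[OF that(1)] norm_one_minus_symbol_le[OF that(2,3)] by blast
  have bounds: "generating p \<and> (\<exists>c1>0. \<exists>c2. (\<forall>t. (\<forall>i. \<bar>t $ i\<bar> \<le> pi) \<longrightarrow> c1 * norm t ^ CARD('n) \<le> Re (1 - symbol p t)) \<and>
         (\<forall>t. cmod (1 - symbol p t) \<le> c2 * norm t ^ CARD('n)))"
    using assms(5)
  proof (elim disjE)
    assume A1: "assumption_A1 M \<xi>"
    then have card: "CARD('n) = 1" and gen: "generating p"
      using aperiodic by (auto simp: assumption_A1_def)
    obtain \<gamma> where "\<gamma> > 0" "(\<lambda>t. symbol p t - complex_of_real (1 - \<gamma> * norm t)) \<in> o[at 0](\<lambda>t. complex_of_real (norm t))"
      using A1 by (auto simp: assumption_A1_def symbol)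
    from symbol_bounds_linear[OF gen this] show ?thesis
      using gen unfolding card power_one_right by blast
  next
    assume A2: "assumption_A2 M \<xi>"
    then have card: "CARD('n) = 2" and gen: "generating p"
      using aperiodic by (auto simp: assumption_A2_def)
    have "integrable (measure_pmf p) (\<lambda>x. (norm (rvec x))\<^sup>2)"
      using A2 assms(2) unfolding p by (subst integrable_distr_eq) (auto simp: assumption_A2_def)
    moreover have "(\<integral>x. rvec x \<partial>measure_pmf p) = 0"
      using A2 assms(2) unfolding p by (subst integral_distr) (auto simp: assumption_A2_def mean_vec_def)
    ultimately show ?thesis using gen quadratic unfolding card by blast
  next
    assume A2': "assumption_A2' M \<xi>"
    then have card: "CARD('n) = 2" by (simp add: assumption_A2'_def)
    have "pmf p e = 1 / 4" if "norm (rvec e) = 1" for e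
    proof -
      have "prob {\<omega> \<in> space M. \<xi> \<omega> = e} = 1 / 4" using A2' that unfolding assumption_A2'_def by blast
      then show ?thesis using prob_law[of "{e}"] by (simp add: measure_pmf_single)
    qed
    note unit = unit_steps[OF card this]
    show ?thesis using unit(1) quadratic[OF unit] unfolding card by blast
  qed
  then obtain c1 c2 where gen: "generating p" and "c1 > 0"
    and "\<And>t. \<forall>i. \<bar>t $ i\<bar> \<le> pi \<Longrightarrow> c1 * norm t ^ CARD('n) \<le> Re (1 - symbol p t)"
    and "\<And>t. cmod (1 - symbol p t) \<le> c2 * norm t ^ CARD('n)"
    by blast
  from green_log_bounds[OF rw this(2,3,4)] obtain c C where "c > 0"
    and "\<forall>\<^sub>F n in sequentially. c * ln (real n) \<le> green p n"
    and "\<forall>\<^sub>F n in sequentially. green p n \<le> C * ln (real n)"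
    by blast
  then show ?thesis by (rule random_walk.AE_folner[OF rw gen])
qed

end
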